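(* Let $v=6t$ where $t\ge 4$ and $t\ne 6$. Then there exists a $(v,3,2)$-BIBD $(X,\mathcal{A})$ that has a strong nesting $\phi:\mathcal{A}\to Y$, $X\subseteq Y$, with $|Y|=w=9t+2$.
   Context: A $(v,k,\lambda)$-BIBD is a pair $(X,\mathcal{A})$ where $X$ is a set of $v$ points and $\mathcal{A}$ is a multiset of $k$-subsets of $X$ (blocks) such that every pair of distinct points lies in exactly $\lambda$ blocks. Given a $(v,k,\lambda)$-BIBD $(X,\mathcal{A})$ and a set $Y\supseteq X$ with $|Y|=w$, a map $\phi:\mathcal{A}\to Y$ is a strong nesting if (1) $\phi(A)\notin A$ for every block $A\in\mathcal{A}$, and (2) the multiset of pairs $\{\{x,\phi(A)\}: A\in\mathcal{A},\ x\in A\}$ (one pair for each block $A$, counted with multiplicity in $\mathcal{A}$, and each $x\in A$) consists of distinct pairs. *)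

theory Defs
  imports Main
begin

text \<open>A (v,k,lambda)-BIBD on point set X, with the multiset of blocks represented
 as an indexed family B over a finite index set I (repeated blocks = distinct indices
 with equal sets).\<close>
definition is_bibd :: "'a set \<Rightarrow> 'i set \<Rightarrow> ('i \<Rightarrow> 'a set) \<Rightarrow> nat \<Rightarrow> nat \<Rightarrow> nat \<Rightarrow> bool" where
  "is_bibd X I B v k lam \<longleftrightarrow>
     finite X \<and> card X = v \<and> finite I \<and>
     (\<forall>i\<in>I. B i \<subseteq> X \<and> card (B i) = k) \<and>
     (\<forall>x\<in>X. \<forall>y\<in>X. x \<noteq> y \<longrightarrow> card {i\<in>I. x \<in> B i \<and> y \<in> B i} = lam)"

definition strong_nesting :: "'i set \<Rightarrow> ('i \<Rightarrow> 'a set) \<Rightarrow> 'a set \<Rightarrow> ('i \<Rightarrow> 'a) \<Rightarrow> bool" where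
  "strong_nesting I B Y phi \<longleftrightarrow>
     (\<forall>i\<in>I. phi i \<in> Y \<and> phi i \<notin> B i) \<and>
     inj_on (\<lambda>(i, x). {x, phi i}) (SIGMA i:I. B i)"

end

theory Submission
  imports Defs "HOL-Number_Theory.Cong" "HOL-Library.Nat_Bijection"
begin

text \<open>
  Put \<open>v = 6t\<close> points into \<open>t\<close> groups of six and attach to each group three outer points.
  Pairs of points from different groups are covered twice: once by a 3-GDD of type \<open>6\<^sup>t\<close> nested
  inside the point set, and once by a Kirkman frame of type \<open>6\<^sup>t\<close>, whose holey parallel classes
  missing a group are nested at the three outer points of that group.  A group is then filled with a
  (6,3,2)-BIBD that is strongly nested in eleven points, namely the group, its three outer points and
  two outer points shared by all groups; altogether \<open>6t + 3t + 2\<close> points.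

  The nested GDD and the frame exist for all \<open>t \<ge> 4\<close> because this set of \<open>t\<close> is closed under
  pairwise balanced designs.  Truncated transversal designs over \<open>\<int>\<^sub>m\<close> reduce everything to
  \<open>t \<in> {4..19} \<union> {23, 27}\<close>, where base blocks under a group \<open>\<int>\<^sub>u \<times> \<int>\<^sub>w\<close> are given.
\<close>

section \<open>Pointed group divisible designs from base blocks\<close>

text \<open>The pairs \<open>{x, phi A}\<close> fall into three classes that cannot collide. The GDD
  uses two inner points of different groups. The frame uses an inner point and an outer point of
  another group, because a block nested at an outer point misses the group of that point. The
  filling uses an inner point and a point of the same group, one of its own outer points or a shared
  one, and such a pair still reveals the group. So each ingredient only has to be strongly nested by
  itself. The first two classes contain \<open>18 * t * (t - 1)\<close> pairs each, three times the
  \<open>6 * t * (t - 1)\<close> blocks of the GDD or of the frame. The fit is exact, so asking that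
  no pair be used twice already makes the blocks nested at an outer point a full holey parallel
  class. The \<open>+ 2\<close> comes from the filling, which nests five blocks at five different
  outer points while a group owns three. \<open>joined\<close> is symmetric in its points because a
  strong nesting compares unordered pairs, and in the GDD the nesting point of one block is an
  ordinary point of others.\<close>

definition joined :: "('p set \<times> 'p) \<Rightarrow> 'p \<Rightarrow> 'p \<Rightarrow> bool" where
  "joined Z p q \<longleftrightarrow> p \<in> fst Z \<and> q = snd Z \<or> q \<in> fst Z \<and> p = snd Z"

text \<open>A point \<open>(i, k)\<close> with \<open>k < 6\<close> lies in group \<open>i\<close>; the labels \<open>6, 7, 8\<close> stand for the three
  outer points of that group.  A pair \<open>(A, y)\<close> is a block \<open>A\<close> nested at \<open>y\<close>: with labels \<open>L = {0..<6}\<close>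
  this is the nested GDD, with \<open>L = {6..<9}\<close> the Kirkman frame.\<close>

definition pointed_gdd :: "'i set \<Rightarrow> nat set \<Rightarrow> (('i \<times> nat) set \<times> ('i \<times> nat)) set \<Rightarrow> bool" where
  "pointed_gdd I L Q \<longleftrightarrow>
     (\<forall>Z\<in>Q. card (fst Z) = 3 \<and> fst Z \<subseteq> I \<times> {..<6} \<and> inj_on fst (fst Z) \<and>
        snd Z \<in> I \<times> L \<and> fst (snd Z) \<notin> fst ` fst Z) \<and>
     (\<forall>p\<in>I \<times> {..<6}. \<forall>q\<in>I \<times> {..<6}. fst p \<noteq> fst q \<longrightarrow> (\<exists>!Z. Z \<in> Q \<and> p \<in> fst Z \<and> q \<in> fst Z)) \<and>
     (\<forall>p q. \<forall>Z\<in>Q. \<forall>Z'\<in>Q. joined Z p q \<longrightarrow> joined Z' p q \<longrightarrow> Z = Z')"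

type_synonym point = "nat \<times> nat"
type_synonym quad = "point \<times> point \<times> point \<times> point"

text \<open>\<open>\<int>\<^sub>u \<times> \<int>\<^sub>w\<close> translates the indices below \<open>u\<close>, fixing the others, and rotates every block of
  \<open>w\<close> consecutive labels.\<close>

definition act :: "nat \<Rightarrow> nat \<Rightarrow> nat \<Rightarrow> nat \<Rightarrow> point \<Rightarrow> point" where
  "act u w g b p = (if fst p < u then (fst p + g) mod u else fst p, w * (snd p div w) + (snd p + b) mod w)"

text \<open>An invariant of the orbit of an ordered pair, packed into one number so that the
  distinctness tests in \<open>base_ok\<close> are cheap.  It need not separate orbits: collisions would
  only make the test fail.\<close>

definition orbit_key :: "nat \<Rightarrow> nat \<Rightarrow> point \<times> point \<Rightarrow> nat" where
  "orbit_key u w = (\<lambda>((i, k), (j, l)).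
     ((((if i < u then 0 else i) * 32 + (if j < u then if i < u then (j + (u - i)) mod u else 0 else j)) * 9
       + k div w) * 9 + l div w) * 3 + (l + (w - k mod w)) mod w)"

definition block_pairs :: "quad \<Rightarrow> (point \<times> point) list" where
  "block_pairs = (\<lambda>(x1, x2, x3, y). [(x1, x2), (x2, x1), (x1, x3), (x3, x1), (x2, x3), (x3, x2)])"

definition nest_pairs :: "quad \<Rightarrow> (point \<times> point) list" where
  "nest_pairs = (\<lambda>(x1, x2, x3, y). [(x1, y), (x2, y), (x3, y), (y, x1), (y, x2), (y, x3)])"

definition quad_ok :: "nat \<Rightarrow> nat \<Rightarrow> nat \<Rightarrow> quad \<Rightarrow> bool" where
  "quad_ok t lo hi = (\<lambda>(x1, x2, x3, y).
     distinct [fst x1, fst x2, fst x3, fst y] \<and>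
     fst x1 < t \<and> fst x2 < t \<and> fst x3 < t \<and> fst y < t \<and>
     snd x1 < 6 \<and> snd x2 < 6 \<and> snd x3 < 6 \<and> lo \<le> snd y \<and> snd y < hi)"

text \<open>The side condition \<open>t \<le> u + 1 \<or> u = 1\<close> makes the action free on pairs with distinct indices;
  then distinct keys and the right number of pairs force every pair to be covered exactly once.\<close>

definition base_ok :: "nat \<Rightarrow> nat \<Rightarrow> nat \<Rightarrow> nat \<Rightarrow> nat \<Rightarrow> quad list \<Rightarrow> bool" where
  "base_ok t u w lo hi B \<longleftrightarrow>
     0 < u \<and> (w = 1 \<or> w = 3) \<and> (t \<le> u + 1 \<or> u = 1) \<and> u \<le> t \<and>
     (lo, hi) \<in> {(0, 6), (6, 9)} \<and>
     6 * length B * u * w = 36 * t * (t - 1) \<and>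
     list_all (quad_ok t lo hi) B \<and>
     distinct (map (orbit_key u w) (concat (map block_pairs B))) \<and>
     distinct (map (orbit_key u w) (concat (map nest_pairs B)))"

section \<open>Orbits of ordered pairs under the group of translations and rotations\<close>

text \<open>Both 6 and 9 are multiples of \<open>w\<close>, so a rotation inside a block of
  \<open>w\<close> labels never crosses these thresholds.\<close>

lemma act_range:
  assumes "0 < u" "u \<le> t" "w = 1 \<or> w = 3" "fst p < t"
  shows "fst (act u w g b p) < t" "snd (act u w g b p) < 6 \<longleftrightarrow> snd p < 6"
    "snd (act u w g b p) < 9 \<longleftrightarrow> snd p < 9"
proof -
  show "fst (act u w g b p) < t"
    using assms(2,4) less_le_trans[OF mod_less_divisor[OF assms(1), of "fst p + g"] assms(2)]
    by (simp add: act_def)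
  have c: "(snd p + b) mod 3 < 3" by simp
  have 6: "snd p < 6 \<longleftrightarrow> snd p div 3 < 2" and 9: "snd p < 9 \<longleftrightarrow> snd p div 3 < 3" by linarith+
  show "snd (act u w g b p) < 6 \<longleftrightarrow> snd p < 6" "snd (act u w g b p) < 9 \<longleftrightarrow> snd p < 9"
    using assms(3) c unfolding 6 9 by (auto simp: act_def)
qed

lemma mod_add_cancel_right:
  fixes k :: nat
  assumes "(k + a) mod m = (k + b) mod m"
  shows "a mod m = b mod m"
  using assms cong_add_lcancel_nat[of k a b m] by (simp add: cong_def)

lemma act_fst_neq:
  assumes "0 < u" "fst p \<noteq> fst q"
  shows "fst (act u w g b p) \<noteq> fst (act u w g b q)"
proof (cases "fst p < u \<and> fst q < u")
  case True
  then show ?thesis using assms mod_add_cancel_right[of g "fst p" u "fst q"]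
    by (auto simp: act_def add.commute)
next
  case False
  have "fst (act u w g b r) < u \<longleftrightarrow> fst r < u" "\<not> fst r < u \<Longrightarrow> fst (act u w g b r) = fst r" for r
    using assms(1) by (simp_all add: act_def)
  with False assms(2) show ?thesis by metis
qed

text \<open>Besides quantities fixed by the action, only differences modulo \<open>u\<close> and
  \<open>w\<close> enter the key. A negative is written as \<open>m - k mod m\<close> because
  subtraction of naturals truncates.\<close>

lemma orbit_key_act:
  assumes "0 < u" "0 < w"
  shows "orbit_key u w (act u w g b p, act u w g b q) = orbit_key u w (p, q)"
proof -
  have shift: "((l + a) mod m + (m - (k + a) mod m)) mod m = (l + (m - k mod m)) mod m" if "0 < m" for a k l m :: nat
  proof (rule mod_add_cancel_right)
    have "(k + a + ((l + a) mod m + (m - (k + a) mod m))) mod m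
      = (l + a + ((k + a) mod m + (m - (k + a) mod m))) mod m"
      by (metis (no_types) add.assoc add.commute mod_add_left_eq)
    also have "\<dots> = (l + a) mod m" using that by simp
    also have "\<dots> = (l + a + (k mod m + (m - k mod m))) mod m" using that by simp
    also have "\<dots> = (k + a + (l + (m - k mod m))) mod m"
      by (metis (no_types) add.assoc add.commute mod_add_left_eq)
    finally show "(k + a + ((l + a) mod m + (m - (k + a) mod m))) mod m = (k + a + (l + (m - k mod m))) mod m" .
  qed
  obtain i k j l where pq: "p = (i, k)" "q = (j, l)" by (cases p, cases q)
  have label: "(w * (l div w) + (l + b) mod w + (w - (k + b) mod w)) mod w = (l + (w - k mod w)) mod w"
    using shift[OF assms(2), of l b k] by (metis add.assoc mod_mult_self4)
  have index: "((j + g) mod u + (u - (i + g) mod u)) mod u = (j + (u - i)) mod u" if "i < u"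
    using shift[OF assms(1), of j g i] that by simp
  have "(i + g) mod u < u" "(j + g) mod u < u" "w * (k div w) + (k + b) mod w = (k + b) mod w + k div w * w"
    "(w * (l div w) + (l + b) mod w) div w = l div w" "(w * (k div w) + (k + b) mod w) div w = k div w"
    "(w * (k div w) + (k + b) mod w) mod w = (k + b) mod w"
    using assms by simp_all
  with label index show ?thesis
    by (cases "i < u"; cases "j < u")
      (simp_all only: pq orbit_key_def act_def prod.case fst_conv snd_conv if_True if_False)
qed

text \<open>Rotation moves every label, so \<open>b\<close> can be read off from either point.
  Reading off \<open>g\<close> takes an index below \<open>u\<close>: if \<open>t <= u + 1\<close>,
  at most one index is fixed, so one of two distinct indices moves; if \<open>u = 1\<close>, there
  is only one translation.\<close>

lemma act_free:
  assumes "0 < u" "t \<le> u + 1 \<or> u = 1" "g < u" "g' < u" "b < w" "b' < w"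
    and "fst x < t" "fst x' < t" "fst x \<noteq> fst x'"
    and "act u w g b x = act u w g' b' x" "act u w g b x' = act u w g' b' x'"
  shows "g = g' \<and> b = b'"
proof -
  have "(snd x + b) mod w = (snd x + b') mod w" using assms(10) by (simp add: act_def)
  from mod_add_cancel_right[OF this] have "b = b'" using assms by simp
  moreover have "g = g'"
  proof (cases "u = 1")
    case False
    then have "fst x < u \<or> fst x' < u" using assms by linarith
    then show ?thesis
    proof
      assume "fst x < u"
      with assms(10) have "(fst x + g) mod u = (fst x + g') mod u" by (simp add: act_def)
      from mod_add_cancel_right[OF this] show ?thesis using assms(3,4) by simp
    next
      assume "fst x' < u"
      with assms(11) have "(fst x' + g) mod u = (fst x' + g') mod u" by (simp add: act_def)
      from mod_add_cancel_right[OF this] show ?thesis using assms(3,4) by simp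
    qed
  qed (use assms in simp)
  ultimately show ?thesis by simp
qed

text \<open>Equal images have equal keys, hence come from the same base pair, and freeness then
  yields the same group element. The base block is carried along as a tag so that an image pair also
  identifies the block it came from.\<close>

lemma inj_on_orbits:
  assumes "0 < u" "0 < w" "t \<le> u + 1 \<or> u = 1"
    and "inj_on (\<lambda>(x, x', Z). orbit_key u w (x, x')) E"
    and "\<And>x x' Z. (x, x', Z) \<in> E \<Longrightarrow> fst x < t \<and> fst x' < t \<and> fst x \<noteq> fst x'"
  shows "inj_on (\<lambda>((x, x', Z), g, b). (act u w g b x, act u w g b x')) (E \<times> {..<u} \<times> {..<w})"
proof (rule inj_onI)
  fix e f
  assume ef: "e \<in> E \<times> {..<u} \<times> {..<w}" "f \<in> E \<times> {..<u} \<times> {..<w}"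
    and eq: "(\<lambda>((x, x', Z), g, b). (act u w g b x, act u w g b x')) e
      = (\<lambda>((x, x', Z), g, b). (act u w g b x, act u w g b x')) f"
  obtain x x' Z g b y y' Z' h c where e: "e = ((x, x', Z), g, b)" and f: "f = ((y, y', Z'), h, c)"
    by (metis surj_pair)
  have 1: "act u w g b x = act u w h c y" "act u w g b x' = act u w h c y'"
    using eq by (auto simp: e f)
  have "orbit_key u w (x, x') = orbit_key u w (y, y')"
    using orbit_key_act[OF assms(1,2)] 1 by metis
  with inj_onD[OF assms(4), of "(x, x', Z)" "(y, y', Z')"] ef
  have eq: "x = y" "x' = y'" "Z = Z'" by (auto simp: e f)
  with act_free[OF assms(1,3), of g h b w c x x'] ef 1 assms(5)[of x x' Z]
  show "e = f" by (auto simp: e f)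
qed

lemma distinct_concat_map_unique:
  assumes "distinct (concat (map f B))" "Z \<in> set B" "Z' \<in> set B" "a \<in> set (f Z)" "a \<in> set (f Z')"
  shows "Z = Z'"
  using assms by (induction B) auto

lemma inj_on_tagged:
  assumes "distinct (map c (concat (map f B)))"
  shows "inj_on (\<lambda>(x, x', Z). c (x, x')) {(x, x', Z). Z \<in> set B \<and> (x, x') \<in> set (f Z)}"
proof (rule inj_onI, clarsimp)
  fix x x' Z y y' Z'
  assume Z: "Z \<in> set B" "Z' \<in> set B" and m: "(x, x') \<in> set (f Z)" "(y, y') \<in> set (f Z')"
    and eq: "c (x, x') = c (y, y')"
  have "inj_on c (set (concat (map f B)))" "distinct (concat (map f B))"
    using assms by (simp_all add: distinct_map)
  moreover have "(x, x') \<in> set (concat (map f B))" "(y, y') \<in> set (concat (map f B))"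
    using Z m by auto
  ultimately have "(x, x') = (y, y')" using eq by (meson inj_onD)
  with distinct_concat_map_unique[OF \<open>distinct (concat (map f B))\<close> Z m(1)] m(2)
  show "x = y \<and> x' = y' \<and> Z = Z'" by simp
qed

definition quad_image :: "nat \<Rightarrow> nat \<Rightarrow> nat \<Rightarrow> nat \<Rightarrow> quad \<Rightarrow> point set \<times> point" where
  "quad_image u w g b = (\<lambda>(x1, x2, x3, y). (act u w g b ` {x1, x2, x3}, act u w g b y))"

lemma block_pairs_image:
  assumes "p \<noteq> q"
  shows "p \<in> fst (quad_image u w g b Z) \<and> q \<in> fst (quad_image u w g b Z) \<Longrightarrow>
    \<exists>x x'. (x, x') \<in> set (block_pairs Z) \<and> p = act u w g b x \<and> q = act u w g b x'"
  using assms by (cases Z) (auto simp: quad_image_def block_pairs_def)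

lemma block_pairs_mem:
  assumes "(x, x') \<in> set (block_pairs Z)"
  shows "act u w g b x \<in> fst (quad_image u w g b Z) \<and> act u w g b x' \<in> fst (quad_image u w g b Z)"
  using assms by (cases Z) (auto simp: quad_image_def block_pairs_def)

lemma nest_pairs_image:
  assumes "joined (quad_image u w g b Z) p q"
  shows "\<exists>x x'. (x, x') \<in> set (nest_pairs Z) \<and> p = act u w g b x \<and> q = act u w g b x'"
  using assms by (cases Z) (auto simp: quad_image_def nest_pairs_def joined_def)

lemma quad_ok_pairs:
  assumes "quad_ok t lo hi Z"
  shows "(x, x') \<in> set (block_pairs Z) \<Longrightarrow> fst x < t \<and> fst x' < t \<and> fst x \<noteq> fst x' \<and> snd x < 6 \<and> snd x' < 6"
    "(x, x') \<in> set (nest_pairs Z) \<Longrightarrow> fst x < t \<and> fst x' < t \<and> fst x \<noteq> fst x'"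
  using assms by (cases Z; auto simp: quad_ok_def block_pairs_def nest_pairs_def)+

lemma card_cross_pairs:
  "card {(p, q) | p q. p \<in> {..<t} \<times> {..<6::nat} \<and> q \<in> {..<t} \<times> {..<6::nat} \<and> fst p \<noteq> fst q}
     = 36 * t * (t - 1)" (is "card ?C = _")
proof -
  have "?C = (SIGMA p:{..<t} \<times> {..<6}. ({..<t} - {fst p}) \<times> {..<6})" by auto
  also have "card \<dots> = 36 * t * (t - 1)"
  proof (subst card_SigmaI)
    have "(\<Sum>p\<in>{..<t} \<times> {..<6::nat}. card (({..<t} - {fst p}) \<times> {..<6::nat}))
      = (\<Sum>p\<in>{..<t} \<times> {..<6::nat}. (t - 1) * 6)"
      by (rule sum.cong) (auto simp: card_cartesian_product)
    then show "(\<Sum>p\<in>{..<t} \<times> {..<6::nat}. card (({..<t} - {fst p}) \<times> {..<6::nat})) = 36 * t * (t - 1)"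
      by (simp add: card_cartesian_product)
  qed auto
  finally show ?thesis .
qed

lemma pointed_gdd_base:
  assumes ok: "base_ok t u w lo hi B"
  shows "\<exists>Q. pointed_gdd {..<t} {lo..<hi} Q"
proof -
  define Q where "Q = (\<lambda>(Z, g, b). quad_image u w g b Z) ` (set B \<times> {..<u} \<times> {..<w})"
  have u: "0 < u" "u \<le> t" "t \<le> u + 1 \<or> u = 1" and w: "0 < w" "w = 1 \<or> w = 3"
    and lohi: "(lo, hi) \<in> {(0, 6), (6, 9)}"
    and count: "6 * length B * u * w = 36 * t * (t - 1)"
    and quad: "\<And>Z. Z \<in> set B \<Longrightarrow> quad_ok t lo hi Z"
    using ok by (auto simp: base_ok_def list_all_iff)
  define E where "E f = {(x, x', Z). Z \<in> set B \<and> (x, x') \<in> set (f Z)}" for f :: "quad \<Rightarrow> (point \<times> point) list"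
  define orb where "orb = (\<lambda>((x, x', Z :: quad), g, b). (act u w g b x, act u w g b x'))"
  have inj_b: "inj_on orb (E block_pairs \<times> {..<u} \<times> {..<w})"
    unfolding orb_def
    by (rule inj_on_orbits[OF u(1) w(1) u(3)], unfold E_def, rule inj_on_tagged)
      (use ok in \<open>auto simp: base_ok_def dest: quad quad_ok_pairs(1)\<close>)
  have inj_n: "inj_on orb (E nest_pairs \<times> {..<u} \<times> {..<w})"
    unfolding orb_def
    by (rule inj_on_orbits[OF u(1) w(1) u(3)], unfold E_def, rule inj_on_tagged)
      (use ok in \<open>auto simp: base_ok_def dest: quad quad_ok_pairs(2)\<close>)
  define C where "C = {(p, q) | p q. p \<in> {..<t} \<times> {..<6::nat} \<and> q \<in> {..<t} \<times> {..<6::nat} \<and> fst p \<noteq> fst q}"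
  have "orb ` (E block_pairs \<times> {..<u} \<times> {..<w}) = C"
  proof (rule card_subset_eq)
    show "finite C" unfolding C_def by (rule finite_subset[of _ "({..<t} \<times> {..<6}) \<times> ({..<t} \<times> {..<6})"]) auto
    show "orb ` (E block_pairs \<times> {..<u} \<times> {..<w}) \<subseteq> C"
    proof clarify
      fix p q :: point and x x' Z g b
      assume "(x, x', Z) \<in> E block_pairs" and pq: "(p, q) = orb ((x, x', Z), g, b)"
      then have x: "fst x < t" "fst x' < t" "fst x \<noteq> fst x'" "snd x < 6" "snd x' < 6"
        using quad_ok_pairs(1)[OF quad, of Z x x'] by (auto simp: E_def)
      have "p = act u w g b x" "q = act u w g b x'" using pq by (simp_all add: orb_def)
      then have "fst p < t \<and> snd p < 6 \<and> fst q < t \<and> snd q < 6 \<and> fst p \<noteq> fst q"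
        using act_fst_neq[OF u(1) x(3), of w g b] act_range[OF u(1,2) w(2)] x by simp
      then show "(p, q) \<in> C" by (cases p; cases q) (simp add: C_def)
    qed
    \<comment> \<open>With \<open>id\<close> as the key: a pair occurs in one base block only, so
      dropping the tag loses nothing, and \<open>E block_pairs\<close> has six elements per base
      block.\<close>
    have "inj_on (\<lambda>(x, x', Z). (x, x')) (E block_pairs)"
      using inj_on_tagged[of id block_pairs B] ok by (simp add: E_def base_ok_def distinct_map)
    then have "card (E block_pairs) = card ((\<lambda>(x, x', Z). (x, x')) ` E block_pairs)"
      by (simp add: card_image)
    also have "(\<lambda>(x, x', Z). (x, x')) ` E block_pairs = set (concat (map block_pairs B))"
      by (force simp: E_def)
    also have "card \<dots> = length (concat (map block_pairs B))"
      using ok by (intro distinct_card) (simp add: base_ok_def distinct_map)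
    also have "\<dots> = 6 * length B"
      by (induction B) (auto simp: block_pairs_def split: prod.splits)
    finally show "card (orb ` (E block_pairs \<times> {..<u} \<times> {..<w})) = card C"
      using count card_cross_pairs[of t]
      by (simp add: card_image[OF inj_b] card_cartesian_product C_def)
  qed
  note surj = this
  have "pointed_gdd {..<t} {lo..<hi} Q"
    unfolding pointed_gdd_def
  proof (intro conjI ballI allI impI)
    fix Z assume "Z \<in> Q"
    then obtain x1 x2 x3 y g b where Z: "Z = quad_image u w g b (x1, x2, x3, y)" "(x1, x2, x3, y) \<in> set B"
      unfolding Q_def by auto
    have q: "quad_ok t lo hi (x1, x2, x3, y)" using quad Z(2) by blast
    have ne: "fst (act u w g b r) \<noteq> fst (act u w g b s)" if "fst r \<noteq> fst s" for r s
      by (rule act_fst_neq[OF u(1) that])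
    have d: "fst x1 \<noteq> fst x2" "fst x1 \<noteq> fst x3" "fst x2 \<noteq> fst x3" "fst x1 \<noteq> fst y" "fst x2 \<noteq> fst y" "fst x3 \<noteq> fst y"
      using q by (auto simp: quad_ok_def)
    note ne' = d[THEN ne]
    show "inj_on fst (fst Z)" "fst (snd Z) \<notin> fst ` fst Z"
      using ne' ne'[symmetric] by (auto simp: Z(1) quad_image_def)
    have "act u w g b x1 \<noteq> act u w g b x2" "act u w g b x1 \<noteq> act u w g b x3" "act u w g b x2 \<noteq> act u w g b x3"
      using ne' by metis+
    then show "card (fst Z) = 3" by (simp add: Z(1) quad_image_def)
    note r = act_range[OF u(1,2) w(2)]
    show "fst Z \<subseteq> {..<t} \<times> {..<6}"
      using q r by (auto simp: Z(1) quad_image_def quad_ok_def mem_Times_iff)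
    \<comment> \<open>The two thresholds together decide between the label ranges
      \<open>{0..<6}\<close> and \<open>{6..<9}\<close>, so the nesting point stays in its
      range.\<close>
    have "snd (act u w g b y) < 6 \<longleftrightarrow> snd y < 6" "snd (act u w g b y) < 9 \<longleftrightarrow> snd y < 9"
      "fst (act u w g b y) < t" using q r(1,2,3)[of y] by (auto simp: quad_ok_def)
    then show "snd Z \<in> {..<t} \<times> {lo..<hi}"
      using q lohi by (auto simp: Z(1) quad_image_def quad_ok_def mem_Times_iff)
  next
    fix p q :: point assume pq: "p \<in> {..<t} \<times> {..<6}" "q \<in> {..<t} \<times> {..<6}" "fst p \<noteq> fst q"
    then have "(p, q) \<in> C" by (cases p; cases q) (simp add: C_def)
    then have "(p, q) \<in> orb ` (E block_pairs \<times> {..<u} \<times> {..<w})" by (simp only: surj)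
    then obtain x x' Z g b where Z: "(x, x', Z) \<in> E block_pairs" "g < u" "b < w"
      "p = act u w g b x" "q = act u w g b x'" by (auto simp: orb_def)
    show "\<exists>!Z. Z \<in> Q \<and> p \<in> fst Z \<and> q \<in> fst Z"
    proof (rule ex1I[of _ "quad_image u w g b Z"])
      show "quad_image u w g b Z \<in> Q \<and> p \<in> fst (quad_image u w g b Z) \<and> q \<in> fst (quad_image u w g b Z)"
        using Z block_pairs_mem[of x x' Z]
        by (auto simp: E_def Q_def intro!: image_eqI[where x = "(Z, g, b)"])
    next
      fix Y assume Y: "Y \<in> Q \<and> p \<in> fst Y \<and> q \<in> fst Y"
      then obtain Z' h c where Z': "Y = quad_image u w h c Z'" "Z' \<in> set B" "h < u" "c < w"
        by (auto simp: Q_def)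
      obtain z z' where z: "(z, z') \<in> set (block_pairs Z')" "p = act u w h c z" "q = act u w h c z'"
        using block_pairs_image[of p q u w h c Z'] Y pq(3) Z'(1) by auto
      have "((x, x', Z), g, b) = ((z, z', Z'), h, c)"
        by (rule inj_onD[OF inj_b]) (use Z Z' z in \<open>auto simp: orb_def E_def\<close>)
      then show "Y = quad_image u w g b Z" using Z'(1) by simp
    qed
  next
    fix p q Y Y' assume Y: "Y \<in> Q" "Y' \<in> Q" "joined Y p q" "joined Y' p q"
    obtain Z g b where Z: "Y = quad_image u w g b Z" "Z \<in> set B" "g < u" "b < w"
      using Y(1) by (auto simp: Q_def)
    obtain Z' h c where Z': "Y' = quad_image u w h c Z'" "Z' \<in> set B" "h < u" "c < w"
      using Y(2) by (auto simp: Q_def)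
    obtain x x' where x: "(x, x') \<in> set (nest_pairs Z)" "p = act u w g b x" "q = act u w g b x'"
      using nest_pairs_image Y(3) Z(1) by blast
    obtain z z' where z: "(z, z') \<in> set (nest_pairs Z')" "p = act u w h c z" "q = act u w h c z'"
      using nest_pairs_image Y(4) Z'(1) by blast
    have "((x, x', Z), g, b) = ((z, z', Z'), h, c)"
      by (rule inj_onD[OF inj_n]) (use Z Z' x z in \<open>auto simp: orb_def E_def\<close>)
    then show "Y = Y'" using Z(1) Z'(1) by simp
  qed
  then show ?thesis by blast
qed

section \<open>Closure under pairwise balanced designs\<close>

lemma pointed_gddD:
  assumes "pointed_gdd I L Q"
  shows "Z \<in> Q \<Longrightarrow> card (fst Z) = 3"
    "Z \<in> Q \<Longrightarrow> p \<in> fst Z \<Longrightarrow> fst p \<in> I \<and> snd p < 6"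
    "Z \<in> Q \<Longrightarrow> inj_on fst (fst Z)"
    "Z \<in> Q \<Longrightarrow> fst (snd Z) \<in> I \<and> snd (snd Z) \<in> L"
    "Z \<in> Q \<Longrightarrow> p \<in> fst Z \<Longrightarrow> fst p \<noteq> fst (snd Z)"
    "p \<in> I \<times> {..<6} \<Longrightarrow> q \<in> I \<times> {..<6} \<Longrightarrow> fst p \<noteq> fst q \<Longrightarrow> \<exists>!Z. Z \<in> Q \<and> p \<in> fst Z \<and> q \<in> fst Z"
    "Z \<in> Q \<Longrightarrow> Z' \<in> Q \<Longrightarrow> joined Z p q \<Longrightarrow> joined Z' p q \<Longrightarrow> Z = Z'"
proof -
  show "Z \<in> Q \<Longrightarrow> card (fst Z) = 3" "Z \<in> Q \<Longrightarrow> inj_on fst (fst Z)"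
    "Z \<in> Q \<Longrightarrow> fst (snd Z) \<in> I \<and> snd (snd Z) \<in> L"
    using assms by (simp_all add: pointed_gdd_def mem_Times_iff)
  have "Z \<in> Q \<Longrightarrow> fst Z \<subseteq> I \<times> {..<6}" using assms by (simp add: pointed_gdd_def)
  from subsetD[OF this, of p] show "Z \<in> Q \<Longrightarrow> p \<in> fst Z \<Longrightarrow> fst p \<in> I \<and> snd p < 6"
    by (simp add: mem_Times_iff)
  show "Z \<in> Q \<Longrightarrow> p \<in> fst Z \<Longrightarrow> fst p \<noteq> fst (snd Z)"
    using assms unfolding pointed_gdd_def by (metis imageI)
  show "p \<in> I \<times> {..<6} \<Longrightarrow> q \<in> I \<times> {..<6} \<Longrightarrow> fst p \<noteq> fst q \<Longrightarrow> \<exists>!Z. Z \<in> Q \<and> p \<in> fst Z \<and> q \<in> fst Z"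
    using assms unfolding pointed_gdd_def by blast
  show "Z \<in> Q \<Longrightarrow> Z' \<in> Q \<Longrightarrow> joined Z p q \<Longrightarrow> joined Z' p q \<Longrightarrow> Z = Z'"
    using assms unfolding pointed_gdd_def by blast
qed

lemma joined_fst:
  assumes "pointed_gdd I L Q" "Z \<in> Q" "joined Z p q"
  shows "fst p \<in> I \<and> fst q \<in> I \<and> fst p \<noteq> fst q"
  using pointed_gddD(2,4,5)[OF assms(1,2)] assms(3) unfolding joined_def by metis

text \<open>Only the number of groups matters. This is what lets a design on \<open>{..<n}\<close>
  be copied onto any block of size \<open>n\<close> of a pairwise balanced design.\<close>

lemma pointed_gdd_transport:
  assumes "pointed_gdd I L Q" "inj_on f I"
  shows "\<exists>Q'. pointed_gdd (f ` I) L Q'"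
proof -
  define h where "h p = (f (fst p), snd p)" for p :: "'a \<times> nat"
  define H where "H = (\<lambda>Z :: ('a \<times> nat) set \<times> ('a \<times> nat). (h ` fst Z, h (snd Z)))"
  have h: "fst (h p) = f (fst p)" "snd (h p) = snd p" for p by (simp_all add: h_def)
  have h_eq: "h p = h q \<longleftrightarrow> p = q" if "fst p \<in> I" "fst q \<in> I" for p q
    using that assms(2) by (auto simp: h_def inj_on_eq_iff prod_eq_iff)
  note D = pointed_gddD[OF assms(1)]
  have mem: "h p \<in> fst (H Z) \<longleftrightarrow> p \<in> fst Z" if "Z \<in> Q" "fst p \<in> I" for p Z
    unfolding H_def fst_conv
  proof (rule inj_on_image_mem_iff)
    show "inj_on h {p. fst p \<in> I}" using h_eq by (auto intro: inj_onI)
    show "fst Z \<subseteq> {p. fst p \<in> I}" using D(2)[OF that(1)] by blast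
  qed (use that in simp)
  have nst: "h p = snd (H Z) \<longleftrightarrow> p = snd Z" if "Z \<in> Q" "fst p \<in> I" for p Z
    unfolding H_def snd_conv using that(2) D(4)[OF that(1)] h_eq by blast
  have pull: "\<exists>p0. p = h p0 \<and> fst p0 \<in> I \<and> snd p0 = snd p" if "fst p \<in> f ` I" for p :: "'b \<times> nat"
    using that by (cases p) (force simp: h_def)
  have "pointed_gdd (f ` I) L (H ` Q)"
    unfolding pointed_gdd_def
  proof (intro conjI ballI allI impI)
    fix Y assume "Y \<in> H ` Q"
    then obtain Z where Z: "Z \<in> Q" "Y = H Z" by blast
    have "inj_on h (fst Z)" using D(2)[OF Z(1)] h_eq by (auto intro!: inj_onI)
    then show "card (fst Y) = 3" using D(1)[OF Z(1)] by (simp add: Z(2) H_def card_image)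
    show "fst Y \<subseteq> f ` I \<times> {..<6}"
    proof
      fix p assume "p \<in> fst Y"
      then obtain p0 where "p = h p0" "p0 \<in> fst Z" by (auto simp: Z(2) H_def)
      then show "p \<in> f ` I \<times> {..<6}" using D(2)[OF Z(1)] by (simp add: h mem_Times_iff)
    qed
    show "inj_on fst (fst Y)"
    proof (rule inj_onI)
      fix p q assume "p \<in> fst Y" "q \<in> fst Y" "fst p = fst q"
      then obtain p0 q0 where 0: "p = h p0" "q = h q0" "p0 \<in> fst Z" "q0 \<in> fst Z" by (auto simp: Z(2) H_def)
      then have "fst p0 = fst q0" using \<open>fst p = fst q\<close> D(2)[OF Z(1)] assms(2) by (simp add: h inj_on_eq_iff)
      then show "p = q" using 0 inj_onD[OF D(3)[OF Z(1)]] by blast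
    qed
    show "snd Y \<in> f ` I \<times> L" using D(4)[OF Z(1)] by (auto simp: Z(2) H_def h mem_Times_iff)
    show "fst (snd Y) \<notin> fst ` fst Y"
    proof
      assume "fst (snd Y) \<in> fst ` fst Y"
      then obtain p where p: "p \<in> fst Z" "f (fst (snd Z)) = f (fst p)" by (auto simp: Z(2) H_def h)
      then show False using D(2,4,5)[OF Z(1)] assms(2) by (metis inj_on_eq_iff)
    qed
  next
    fix p q :: "'b \<times> nat"
    assume pq: "p \<in> f ` I \<times> {..<6}" "q \<in> f ` I \<times> {..<6}" "fst p \<noteq> fst q"
    obtain p0 where p0: "p = h p0" "fst p0 \<in> I" "snd p0 < 6" using pull[of p] pq(1) by (auto simp: mem_Times_iff)
    obtain q0 where q0: "q = h q0" "fst q0 \<in> I" "snd q0 < 6" using pull[of q] pq(2) by (auto simp: mem_Times_iff)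
    have "\<exists>!Z. Z \<in> Q \<and> p0 \<in> fst Z \<and> q0 \<in> fst Z"
      using pq(3) p0 q0 by (intro D(6)) (auto simp: mem_Times_iff h)
    then obtain Z where Z: "Z \<in> Q" "p0 \<in> fst Z" "q0 \<in> fst Z"
      and uniq: "\<And>Z'. Z' \<in> Q \<Longrightarrow> p0 \<in> fst Z' \<Longrightarrow> q0 \<in> fst Z' \<Longrightarrow> Z' = Z" by blast
    show "\<exists>!Y. Y \<in> H ` Q \<and> p \<in> fst Y \<and> q \<in> fst Y"
    proof (rule ex1I[of _ "H Z"])
      show "H Z \<in> H ` Q \<and> p \<in> fst (H Z) \<and> q \<in> fst (H Z)" using Z mem p0 q0 by simp
      fix Y assume Y: "Y \<in> H ` Q \<and> p \<in> fst Y \<and> q \<in> fst Y"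
      then obtain Z' where "Z' \<in> Q" "Y = H Z'" by blast
      with Y mem p0 q0 uniq show "Y = H Z" by simp
    qed
  next
    fix p q :: "'b \<times> nat" and Y Y'
    assume Y: "Y \<in> H ` Q" "Y' \<in> H ` Q" "joined Y p q" "joined Y' p q"
    obtain Z Z' where Z: "Z \<in> Q" "Y = H Z" "Z' \<in> Q" "Y' = H Z'" using Y(1,2) by blast
    have "fst p \<in> f ` I" "fst q \<in> f ` I"
      using Y(3) D(2,4)[OF Z(1)] by (auto simp: joined_def Z(2) H_def h)
    then obtain p0 q0 where 0: "p = h p0" "fst p0 \<in> I" "q = h q0" "fst q0 \<in> I" using pull by meson
    have "joined Z p0 q0" "joined Z' p0 q0"
      using Y(3,4) 0 mem nst Z by (simp_all add: joined_def)
    then show "Y = Y'" using D(7) Z by metis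
  qed
  then show ?thesis by blast
qed

definition admissible :: "nat \<Rightarrow> bool" where
  "admissible t \<longleftrightarrow> (\<forall>L\<in>{{0..<6}, {6..<9}}. \<exists>Q. pointed_gdd {..<t} L Q)"

lemma admissible_pointed_gdd:
  assumes "admissible (card I)" "finite I" "L \<in> {{0..<6}, {6..<9}}"
  shows "\<exists>Q. pointed_gdd I L Q"
proof -
  obtain f where f: "bij_betw f {..<card I} I"
    using ex_bij_betw_nat_finite[OF assms(2)] by (auto simp: atLeast0LessThan)
  obtain Q where "pointed_gdd {..<card I} L Q" using assms(1,3) by (auto simp: admissible_def)
  from pointed_gdd_transport[OF this bij_betw_imp_inj_on[OF f]] show ?thesis
    using f by (simp add: bij_betw_def)
qed

text \<open>All conditions on a pointed design concern a pair of distinct indices, and such a pair lies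
  in exactly one block of a pairwise balanced design; so the designs on its blocks glue together.\<close>
lemma admissible_pbd:
  assumes "finite T"
    and "\<And>\<beta>. \<beta> \<in> \<B> \<Longrightarrow> \<beta> \<subseteq> T \<and> admissible (card \<beta>)"
    and "\<And>i j. i \<in> T \<Longrightarrow> j \<in> T \<Longrightarrow> i \<noteq> j \<Longrightarrow> \<exists>!\<beta>. \<beta> \<in> \<B> \<and> i \<in> \<beta> \<and> j \<in> \<beta>"
  shows "admissible (card T)"
  unfolding admissible_def
proof
  fix L :: "nat set" assume L: "L \<in> {{0..<6}, {6..<9}}"
  have "\<exists>Q. pointed_gdd \<beta> L Q" if "\<beta> \<in> \<B>" for \<beta>
    using admissible_pointed_gdd[OF _ _ L, of \<beta>] assms(2)[OF that] finite_subset[OF _ assms(1)] by blast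
  then obtain Q where Q: "\<And>\<beta>. \<beta> \<in> \<B> \<Longrightarrow> pointed_gdd \<beta> L (Q \<beta>)" by metis
  have uniq: "\<beta> = \<gamma>" if "\<beta> \<in> \<B>" "\<gamma> \<in> \<B>" "i \<in> \<beta>" "j \<in> \<beta>" "i \<in> \<gamma>" "j \<in> \<gamma>" "i \<noteq> j" for i j \<beta> \<gamma>
  proof -
    have "i \<in> T" "j \<in> T" using that assms(2) by blast+
    from assms(3)[OF this that(7)] that show ?thesis by blast
  qed
  have "pointed_gdd T L (\<Union>\<beta>\<in>\<B>. Q \<beta>)"
    unfolding pointed_gdd_def
  proof (intro conjI ballI allI impI)
    fix Z assume "Z \<in> (\<Union>\<beta>\<in>\<B>. Q \<beta>)"
    then obtain \<beta> where \<beta>: "\<beta> \<in> \<B>" "Z \<in> Q \<beta>" by blast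
    note D = pointed_gddD[OF Q[OF \<beta>(1)]]
    show "card (fst Z) = 3" "inj_on fst (fst Z)" by (fact D(1)[OF \<beta>(2)], fact D(3)[OF \<beta>(2)])
    show "fst Z \<subseteq> T \<times> {..<6}" "snd Z \<in> T \<times> L"
      using D(2,4)[OF \<beta>(2)] assms(2)[OF \<beta>(1)] by (auto simp: mem_Times_iff)
    show "fst (snd Z) \<notin> fst ` fst Z" using D(5)[OF \<beta>(2)] by (metis imageE)
  next
    fix p q :: "'a \<times> nat"
    assume pq: "p \<in> T \<times> {..<6}" "q \<in> T \<times> {..<6}" "fst p \<noteq> fst q"
    then obtain \<beta> where \<beta>: "\<beta> \<in> \<B>" "fst p \<in> \<beta>" "fst q \<in> \<beta>"
      using assms(3)[of "fst p" "fst q"] by (auto simp: mem_Times_iff)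
    note D = pointed_gddD[OF Q[OF \<beta>(1)]]
    have "\<exists>!Z. Z \<in> Q \<beta> \<and> p \<in> fst Z \<and> q \<in> fst Z"
      using pq \<beta> by (intro D(6)) (auto simp: mem_Times_iff)
    then obtain W where W: "W \<in> Q \<beta>" "p \<in> fst W" "q \<in> fst W"
      and W_uniq: "\<And>Z. Z \<in> Q \<beta> \<Longrightarrow> p \<in> fst Z \<Longrightarrow> q \<in> fst Z \<Longrightarrow> Z = W" by blast
    \<comment> \<open>A block from the design on some other \<open>\<gamma>\<close> would put both
      indices into \<open>\<gamma>\<close>, although \<open>\<beta>\<close> is the only member of
      \<open>\<B>\<close> containing them.\<close>
    have local: "Z \<in> Q \<beta>" if Z: "Z \<in> (\<Union>\<beta>\<in>\<B>. Q \<beta>)" "p \<in> fst Z" "q \<in> fst Z" for Z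
    proof -
      obtain \<gamma> where \<gamma>: "\<gamma> \<in> \<B>" "Z \<in> Q \<gamma>" using Z(1) by blast
      then have "fst p \<in> \<gamma>" "fst q \<in> \<gamma>" using pointed_gddD(2)[OF Q[OF \<gamma>(1)] \<gamma>(2)] Z(2,3) by blast+
      with uniq[OF \<gamma>(1) \<beta>(1)] \<beta> pq(3) \<gamma> show ?thesis by blast
    qed
    show "\<exists>!Z. Z \<in> (\<Union>\<beta>\<in>\<B>. Q \<beta>) \<and> p \<in> fst Z \<and> q \<in> fst Z"
    proof (rule ex1I[of _ W])
      show "W \<in> (\<Union>\<beta>\<in>\<B>. Q \<beta>) \<and> p \<in> fst W \<and> q \<in> fst W" using W \<beta>(1) by blast
    qed (use local W_uniq in blast)
  next
    fix p q :: "'a \<times> nat" and Z Z'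
    assume Z: "Z \<in> (\<Union>\<beta>\<in>\<B>. Q \<beta>)" "Z' \<in> (\<Union>\<beta>\<in>\<B>. Q \<beta>)" "joined Z p q" "joined Z' p q"
    obtain \<beta> \<gamma> where \<beta>: "\<beta> \<in> \<B>" "Z \<in> Q \<beta>" and \<gamma>: "\<gamma> \<in> \<B>" "Z' \<in> Q \<gamma>" using Z(1,2) by blast
    \<comment> \<open>A nested pair also has two distinct indices, as the nesting point lies in none
      of the groups met by its block. So a conflict between nestings cannot involve two different
      members of \<open>\<B>\<close>.\<close>
    have "\<gamma> = \<beta>"
      by (rule uniq[OF \<gamma>(1) \<beta>(1), of "fst p" "fst q"])
        (use joined_fst[OF Q[OF \<beta>(1)] \<beta>(2) Z(3)] joined_fst[OF Q[OF \<gamma>(1)] \<gamma>(2) Z(4)] in simp_all)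
    then show "Z = Z'" using pointed_gddD(7)[OF Q[OF \<beta>(1)]] \<beta> \<gamma> Z(3,4) by blast
  qed
  then show "\<exists>Q. pointed_gdd {..<card T} L Q"
  proof -
    assume n: "pointed_gdd T L (\<Union>\<beta>\<in>\<B>. Q \<beta>)"
    obtain f where f: "bij_betw f T {..<card T}"
      using ex_bij_betw_finite_nat[OF assms(1)] by (auto simp: atLeast0LessThan)
    from pointed_gdd_transport[OF n bij_betw_imp_inj_on[OF f]] f show ?thesis
      by (simp add: bij_betw_def)
  qed
qed

section \<open>Truncated transversal designs over the integers modulo m\<close>

text \<open>Index \<open>0\<close> plays the part of the group at infinity, which records the slope.\<close>

definition line :: "nat \<Rightarrow> nat \<Rightarrow> nat \<Rightarrow> nat \<Rightarrow> nat" where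
  "line m a b j = (if j = 0 then b else (a + j * b) mod m)"

text \<open>For \<open>1 <= i < j < k\<close> the difference \<open>j - i\<close> is at most
  \<open>k - 2\<close>, hence a unit modulo \<open>m\<close>, and the two linear equations determine
  slope and intercept. For \<open>i = 0\<close> the slope is \<open>x\<close> itself and only
  \<open>a\<close> is unknown.\<close>

lemma line_unique:
  assumes "0 < m" "\<And>d. 0 < d \<Longrightarrow> d + 1 < k \<Longrightarrow> coprime d m"
    and "i < j" "j < k" "x < m" "y < m"
  shows "\<exists>!(a, b). a < m \<and> b < m \<and> line m a b i = x \<and> line m a b j = y"
proof -
  have ex_a: "\<exists>a<m. (a + c) mod m = z" if "z < m" for c z
  proof (intro exI[of _ "(z + (m - c mod m)) mod m"] conjI)
    have "((z + (m - c mod m)) mod m + c) mod m = (z + ((m - c mod m) + c mod m)) mod m"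
      by (metis add.assoc mod_add_left_eq mod_add_right_eq)
    then show "((z + (m - c mod m)) mod m + c) mod m = z" using assms(1) that by simp
  qed (use assms(1) in simp)
  have uniq_a: "a = a'" if "(a + c) mod m = (a' + c) mod m" "a < m" "a' < m" for a a' c
    using mod_add_cancel_right[of c a m a'] that by (simp add: add.commute)
  show ?thesis
  proof (cases "i = 0")
    case True
    obtain a where a: "a < m" "(a + j * x) mod m = y" using ex_a[OF assms(6)] by blast
    show ?thesis
    proof (rule ex1I[of _ "(a, x)"])
      show "case (a, x) of (a, b) \<Rightarrow> a < m \<and> b < m \<and> line m a b i = x \<and> line m a b j = y"
        using a assms True by (simp add: line_def)
    next
      fix ab assume "case ab of (a, b) \<Rightarrow> a < m \<and> b < m \<and> line m a b i = x \<and> line m a b j = y"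
      then obtain a' where ab: "ab = (a', x)" "a' < m" "(a' + j * x) mod m = y"
        using True assms(3) by (auto simp: line_def)
      with uniq_a[of a' "j * x" a] a show "ab = (a, x)" by simp
    qed
  next
    case False
    have cop: "coprime (j - i) m" using assms(2)[of "j - i"] assms False by auto
    have step: "a + j * b = a + i * b + (j - i) * b" for a b :: nat
      using assms(3) by (metis add.assoc add_mult_distrib le_add_diff_inverse less_imp_le)
    obtain s where s: "[(j - i) * s = 1] (mod m)" using cong_solve_coprime_nat[OF cop] by auto
    \<comment> \<open>The slope \<open>(y - x) / (j - i)\<close>, with \<open>s\<close> the inverse
      of \<open>j - i\<close> and \<open>m - x\<close> in place of \<open>-x\<close>.\<close>
    define b where "b = (s * (y + (m - x))) mod m"
    have "b < m" using assms(1) by (simp add: b_def)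
    have "[(j - i) * b = (j - i) * s * (y + (m - x))] (mod m)"
      by (simp add: b_def cong_def mod_mult_right_eq mult.assoc)
    moreover have "[(j - i) * s * (y + (m - x)) = 1 * (y + (m - x))] (mod m)"
      using s by (rule cong_scalar_right)
    ultimately have b: "[(j - i) * b = y + (m - x)] (mod m)" using cong_trans by fastforce
    obtain a where a: "a < m" "(a + i * b) mod m = x" using ex_a[OF assms(5)] by blast
    have "(a + j * b) mod m = (x + (y + (m - x))) mod m"
      using a(2) b unfolding step cong_def by (metis mod_add_left_eq mod_add_right_eq)
    also have "\<dots> = y" using assms(5,6) by simp
    finally have aj: "(a + j * b) mod m = y" .
    show ?thesis
    proof (rule ex1I[of _ "(a, b)"])
      show "case (a, b) of (a, b) \<Rightarrow> a < m \<and> b < m \<and> line m a b i = x \<and> line m a b j = y"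
        using a aj \<open>b < m\<close> False assms(3) by (simp add: line_def)
    next
      fix ab assume "case ab of (a, b) \<Rightarrow> a < m \<and> b < m \<and> line m a b i = x \<and> line m a b j = y"
      then obtain a' b' where ab: "ab = (a', b')" "a' < m" "b' < m"
        "(a' + i * b') mod m = x" "(a' + j * b') mod m = y"
        using False assms(3) by (auto simp: line_def)
      have "(x + (j - i) * b') mod m = (x + (j - i) * b) mod m"
        using ab(4,5) a(2) aj unfolding step by (metis mod_add_left_eq)
      from mod_add_cancel_right[OF this] have "[(j - i) * b' = (j - i) * b] (mod m)"
        by (simp add: cong_def)
      then have "[b' = b] (mod m)" using cong_mult_lcancel_nat[OF cop] by blast
      then have "b' = b" using ab(3) \<open>b < m\<close> by (simp add: cong_def)
      with uniq_a[of a' "i * b" a] ab a show "ab = (a, b)" by simp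
    qed
  qed
qed


text \<open>All groups but the first four may be truncated. The four full groups leave at least four
  points on every line, so line sizes range from 4 to \<open>k\<close>. A group with at most one
  point contains no pair, so it is not taken as a block and its size may be 0 or 1.\<close>

lemma admissible_transversal_design:
  assumes k: "4 \<le> k" and m: "0 < m" "\<And>d. 0 < d \<Longrightarrow> d + 1 < k \<Longrightarrow> coprime d m"
    and full: "\<And>j. j < 4 \<Longrightarrow> s j = m" and s: "\<And>j. j < k \<Longrightarrow> s j \<le> m \<and> (s j \<le> 1 \<or> admissible (s j))"
    and size: "\<And>n. 4 \<le> n \<Longrightarrow> n \<le> k \<Longrightarrow> admissible n"
  shows "admissible (\<Sum>j<k. s j)"
proof -
  define T where "T = (SIGMA j:{..<k}. {..<s j})"
  define G where "G j = {j} \<times> {..<s j}" for j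
  define N where "N a b = T \<inter> (\<lambda>j. (j, line m a b j)) ` {..<k}" for a b
  define \<B> where "\<B> = {G j | j. j < k \<and> 1 < s j} \<union> {N a b | a b. a < m \<and> b < m}"
  have memN: "(j, x) \<in> N a b \<longleftrightarrow> (j, x) \<in> T \<and> x = line m a b j" for j x a b
    by (auto simp: N_def T_def)
  have memG: "(j, x) \<in> G i \<longleftrightarrow> j = i \<and> x < s i" for j x i
    by (auto simp: G_def)
  have memT: "(j, x) \<in> T \<longleftrightarrow> j < k \<and> x < s j" for j x
    by (simp add: T_def)
  have finT: "finite T" by (simp add: T_def)
  have "admissible (card T)"
  proof (rule admissible_pbd[OF finT, of \<B>])
    fix \<beta> assume "\<beta> \<in> \<B>"
    then consider j where "\<beta> = G j" "j < k" "1 < s j" | a b where "\<beta> = N a b" "a < m" "b < m"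
      unfolding \<B>_def by blast
    then show "\<beta> \<subseteq> T \<and> admissible (card \<beta>)"
    proof cases
      case 1
      then show ?thesis using s[of j] by (auto simp: G_def T_def card_cartesian_product)
    next
      case 2
      have line: "line m a b j < m" for j using 2 m(1) by (simp add: line_def)
      have "card ((\<lambda>j. (j, line m a b j)) ` {..<4}) \<le> card \<beta>"
      proof (rule card_mono)
        show "finite \<beta>" using finT by (simp add: 2(1) N_def)
        show "(\<lambda>j. (j, line m a b j)) ` {..<4} \<subseteq> \<beta>"
          using k line full by (auto simp: 2(1) memN memT)
      qed
      moreover have "card ((\<lambda>j. (j, line m a b j)) ` {..<4}) = 4"
        by (subst card_image) (auto intro: inj_onI)
      moreover have "card \<beta> \<le> card ((\<lambda>j. (j, line m a b j)) ` {..<k})"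
        unfolding 2(1) N_def by (rule card_mono) auto
      moreover have "card ((\<lambda>j. (j, line m a b j)) ` {..<k}) \<le> k"
        using card_image_le[of "{..<k}"] by fastforce
      ultimately show ?thesis using size[of "card \<beta>"] by (auto simp: 2(1) N_def)
    qed
  next
    fix p q assume pq: "p \<in> T" "q \<in> T" "p \<noteq> q"
    obtain i x j y where p: "p = (i, x)" and q: "q = (j, y)" by (cases p, cases q)
    have lt: "i < k" "x < s i" "j < k" "y < s j" "x < m" "y < m"
      using pq s[of i] s[of j] by (auto simp: p q memT)
    show "\<exists>!\<beta>. \<beta> \<in> \<B> \<and> p \<in> \<beta> \<and> q \<in> \<beta>"
    proof (cases "i = j")
      case True
      then have "x \<noteq> y" using pq(3) by (simp add: p q)
      show ?thesis
      proof (rule ex1I[of _ "G i"])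
        show "G i \<in> \<B> \<and> p \<in> G i \<and> q \<in> G i"
          using lt True \<open>x \<noteq> y\<close> unfolding \<B>_def p q memG by fastforce
        fix \<beta> assume "\<beta> \<in> \<B> \<and> p \<in> \<beta> \<and> q \<in> \<beta>"
        then show "\<beta> = G i"
          using True \<open>x \<noteq> y\<close> unfolding \<B>_def p q by (auto simp: memN memG)
      qed
    next
      case False
      have "\<exists>!(a, b). a < m \<and> b < m \<and> line m a b i = x \<and> line m a b j = y"
      proof (cases "i < j")
        case True
        from line_unique[OF m True lt(3,5,6)] show ?thesis .
      next
        case False
        with \<open>i \<noteq> j\<close> have "j < i" by simp
        from line_unique[OF m this lt(1,6,5)] show ?thesis by (simp add: conj_ac)
      qed
      then obtain c where c: "case c of (a, b) \<Rightarrow> a < m \<and> b < m \<and> line m a b i = x \<and> line m a b j = y"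
        and c_uniq: "\<And>d. case d of (a, b) \<Rightarrow> a < m \<and> b < m \<and> line m a b i = x \<and> line m a b j = y \<Longrightarrow> d = c"
        by (rule ex1E) blast
      obtain a b where c_eq: "c = (a, b)" by (cases c)
      have ab: "a < m" "b < m" "line m a b i = x" "line m a b j = y" using c by (simp_all add: c_eq)
      have uniq: "a' = a \<and> b' = b" if "a' < m" "b' < m" "line m a' b' i = x" "line m a' b' j = y" for a' b'
        using c_uniq[of "(a', b')"] that by (simp add: c_eq)
      show ?thesis
      proof (rule ex1I[of _ "N a b"])
        show "N a b \<in> \<B> \<and> p \<in> N a b \<and> q \<in> N a b"
          using ab pq unfolding \<B>_def p q memN by blast
        fix \<beta> assume \<beta>: "\<beta> \<in> \<B> \<and> p \<in> \<beta> \<and> q \<in> \<beta>"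
        have "\<beta> \<noteq> G l" for l using \<beta> False by (auto simp: p q memG)
        then obtain a' b' where "\<beta> = N a' b'" "a' < m" "b' < m" using \<beta> unfolding \<B>_def by blast
        then show "\<beta> = N a b" using \<beta> uniq[of a' b'] by (simp add: p q memN)
      qed
    qed
  qed
  then show ?thesis by (simp add: T_def)
qed

section \<open>Small numbers of groups\<close>

lemma admissibleI:
  assumes "base_ok t u w 0 6 B" "base_ok t u' w' 6 9 B'"
  shows "admissible t"
  using pointed_gdd_base[OF assms(1)] pointed_gdd_base[OF assms(2)] by (simp add: admissible_def)

lemmas base_ok_simps = base_ok_def orbit_key_def block_pairs_def nest_pairs_def quad_ok_def

text \<open>The base blocks below were found by computer search (exact cover, respectively SAT solving).\<close>

lemma base_inner_4: "base_ok 4 1 3 0 6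
     [((0, 1), (1, 2), (3, 4), (2, 0)), ((0, 3), (1, 1), (3, 5), (2, 0)),
      ((1, 3), (2, 2), (3, 3), (0, 3)), ((0, 0), (2, 0), (3, 5), (1, 3)),
      ((0, 5), (2, 0), (3, 3), (1, 0)), ((0, 2), (1, 5), (2, 0), (3, 3)),
      ((1, 2), (2, 3), (3, 5), (0, 0)), ((0, 0), (1, 2), (2, 5), (3, 3)),
      ((0, 4), (1, 1), (2, 3), (3, 3)), ((0, 5), (1, 4), (3, 5), (2, 3)),
      ((0, 2), (2, 3), (3, 3), (1, 3)), ((1, 5), (2, 3), (3, 4), (0, 3)),
      ((0, 1), (1, 1), (2, 0), (3, 0)), ((1, 5), (2, 4), (3, 0), (0, 0)),
      ((0, 1), (1, 5), (3, 1), (2, 3)), ((0, 5), (1, 3), (2, 3), (3, 0)),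
      ((0, 2), (2, 5), (3, 0), (1, 0)), ((0, 4), (1, 4), (2, 1), (3, 0)),
      ((0, 5), (2, 1), (3, 1), (1, 3)), ((0, 4), (2, 4), (3, 1), (1, 0)),
      ((1, 0), (2, 0), (3, 1), (0, 0)), ((0, 4), (1, 0), (3, 2), (2, 3)),
      ((0, 2), (1, 4), (3, 1), (2, 0)), ((1, 0), (2, 1), (3, 0), (0, 3))]"
  by (simp add: base_ok_simps)

text \<open>Here \<open>u = w = 1\<close>: the group is trivial, and all
  \<open>6 * 4 * 3 = 72\<close> blocks of the frame are listed.\<close>

lemma base_outer_4: "base_ok 4 1 1 6 9
     [((0, 0), (1, 0), (3, 0), (2, 8)), ((0, 0), (1, 1), (3, 5), (2, 6)),
      ((0, 0), (1, 2), (3, 3), (2, 7)), ((0, 0), (1, 3), (2, 3), (3, 8)),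
      ((0, 0), (1, 4), (2, 2), (3, 6)), ((0, 0), (1, 5), (2, 5), (3, 7)),
      ((0, 0), (2, 0), (3, 2), (1, 8)), ((0, 0), (2, 1), (3, 1), (1, 6)),
      ((0, 0), (2, 4), (3, 4), (1, 7)), ((0, 1), (1, 0), (2, 0), (3, 8)),
      ((0, 1), (1, 1), (2, 1), (3, 6)), ((0, 1), (1, 2), (2, 4), (3, 7)),
      ((0, 1), (1, 3), (3, 2), (2, 8)), ((0, 1), (1, 4), (3, 3), (2, 6)),
      ((0, 1), (1, 5), (3, 5), (2, 7)), ((0, 1), (2, 2), (3, 4), (1, 6)),
      ((0, 1), (2, 3), (3, 0), (1, 8)), ((0, 1), (2, 5), (3, 1), (1, 7)),
      ((0, 2), (1, 0), (3, 4), (2, 6)), ((0, 2), (1, 1), (3, 0), (2, 7)),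
      ((0, 2), (1, 2), (2, 3), (3, 6)), ((0, 2), (1, 3), (2, 1), (3, 7)),
      ((0, 2), (1, 4), (3, 5), (2, 8)), ((0, 2), (1, 5), (2, 2), (3, 8)),
      ((0, 2), (2, 0), (3, 3), (1, 7)), ((0, 2), (2, 4), (3, 1), (1, 8)),
      ((0, 2), (2, 5), (3, 2), (1, 6)), ((0, 3), (1, 0), (3, 1), (2, 7)),
      ((0, 3), (1, 1), (2, 5), (3, 8)), ((0, 3), (1, 2), (3, 4), (2, 8)),
      ((0, 3), (1, 3), (2, 4), (3, 6)), ((0, 3), (1, 4), (2, 0), (3, 7)),
      ((0, 3), (1, 5), (3, 0), (2, 6)), ((0, 3), (2, 1), (3, 5), (1, 8)),
      ((0, 3), (2, 2), (3, 2), (1, 7)), ((0, 3), (2, 3), (3, 3), (1, 6)),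
      ((0, 4), (1, 0), (2, 2), (3, 7)), ((0, 4), (1, 1), (3, 3), (2, 8)),
      ((0, 4), (1, 2), (2, 1), (3, 8)), ((0, 4), (1, 3), (3, 1), (2, 6)),
      ((0, 4), (1, 4), (3, 2), (2, 7)), ((0, 4), (1, 5), (2, 0), (3, 6)),
      ((0, 4), (2, 3), (3, 5), (1, 7)), ((0, 4), (2, 4), (3, 0), (1, 6)),
      ((0, 4), (2, 5), (3, 4), (1, 8)), ((0, 5), (1, 0), (2, 5), (3, 6)),
      ((0, 5), (1, 1), (2, 3), (3, 7)), ((0, 5), (1, 2), (3, 2), (2, 6)),
      ((0, 5), (1, 3), (3, 4), (2, 7)), ((0, 5), (1, 4), (2, 4), (3, 8)),
      ((0, 5), (1, 5), (3, 1), (2, 8)), ((0, 5), (2, 0), (3, 5), (1, 6)),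
      ((0, 5), (2, 1), (3, 0), (1, 7)), ((0, 5), (2, 2), (3, 3), (1, 8)),
      ((1, 0), (2, 1), (3, 3), (0, 6)), ((1, 0), (2, 3), (3, 2), (0, 7)),
      ((1, 0), (2, 4), (3, 5), (0, 8)), ((1, 1), (2, 0), (3, 4), (0, 8)),
      ((1, 1), (2, 2), (3, 1), (0, 7)), ((1, 1), (2, 4), (3, 2), (0, 6)),
      ((1, 2), (2, 0), (3, 1), (0, 6)), ((1, 2), (2, 2), (3, 0), (0, 8)),
      ((1, 2), (2, 5), (3, 5), (0, 7)), ((1, 3), (2, 0), (3, 0), (0, 7)),
      ((1, 3), (2, 2), (3, 5), (0, 6)), ((1, 3), (2, 5), (3, 3), (0, 8)),
      ((1, 4), (2, 1), (3, 4), (0, 7)), ((1, 4), (2, 3), (3, 1), (0, 8)),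
      ((1, 4), (2, 5), (3, 0), (0, 6)), ((1, 5), (2, 1), (3, 2), (0, 8)),
      ((1, 5), (2, 3), (3, 4), (0, 6)), ((1, 5), (2, 4), (3, 3), (0, 7))]"
  by (simp add: base_ok_simps)

text \<open>For odd \<open>t\<close> the group has order \<open>3 * t\<close> and moves every index,
  which leaves \<open>2 * (t - 1)\<close> base blocks. Each is shifted so that its nesting point is
  \<open>(0, 0)\<close>, \<open>(0, 3)\<close> or \<open>(0, 6)\<close>.\<close>

lemma base_inner_5: "base_ok 5 5 3 0 6
     [((1, 3), (2, 0), (4, 2), (0, 0)), ((2, 5), (3, 5), (4, 1), (0, 0)),
      ((2, 2), (3, 2), (4, 0), (0, 0)), ((1, 0), (2, 2), (3, 3), (0, 3)),
      ((1, 5), (3, 3), (4, 5), (0, 0)), ((1, 5), (3, 0), (4, 3), (0, 3)),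
      ((1, 2), (2, 4), (3, 2), (0, 3)), ((1, 4), (2, 5), (4, 2), (0, 3))]"
  by (simp add: base_ok_simps)

lemma base_outer_5: "base_ok 5 5 3 6 9
     [((1, 4), (3, 0), (4, 3), (0, 6)), ((2, 3), (3, 5), (4, 5), (0, 6)),
      ((1, 2), (2, 4), (4, 4), (0, 6)), ((1, 1), (2, 5), (3, 3), (0, 6)),
      ((1, 0), (3, 4), (4, 2), (0, 6)), ((1, 3), (2, 0), (4, 0), (0, 6)),
      ((1, 5), (2, 1), (3, 2), (0, 6)), ((2, 2), (3, 1), (4, 1), (0, 6))]"
  by (simp add: base_ok_simps)

text \<open>For even \<open>t\<close> above 4 the index \<open>t - 1\<close> is a fixed point at
  infinity and the translations act modulo \<open>t - 1\<close>, which leaves \<open>2 * t\<close>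
  base blocks. Two or more of the blocks of each list involve the fixed index as nesting
  index.\<close>

lemma base_inner_6: "base_ok 6 5 3 0 6
     [((1, 3), (2, 3), (4, 4), (0, 3)), ((1, 3), (2, 2), (4, 3), (0, 0)),
      ((1, 2), (2, 1), (3, 1), (0, 3)), ((1, 1), (3, 3), (4, 1), (0, 0)),
      ((0, 1), (2, 2), (3, 4), (5, 0)), ((2, 4), (4, 2), (5, 1), (0, 3)),
      ((3, 2), (4, 5), (5, 0), (0, 3)), ((2, 0), (3, 4), (5, 0), (0, 0)),
      ((1, 1), (3, 4), (5, 4), (0, 3)), ((0, 0), (3, 4), (4, 3), (5, 3)),
      ((1, 5), (2, 3), (5, 4), (0, 0)), ((1, 0), (2, 1), (5, 5), (0, 0))]"
  by (simp add: base_ok_simps)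

lemma base_outer_6: "base_ok 6 5 3 6 9
     [((1, 4), (2, 5), (4, 5), (0, 6)), ((2, 2), (3, 4), (4, 4), (0, 6)),
      ((1, 5), (3, 3), (5, 3), (0, 6)), ((0, 0), (3, 5), (4, 4), (5, 6)),
      ((0, 3), (1, 1), (3, 2), (5, 6)), ((1, 1), (2, 1), (3, 0), (0, 6)),
      ((2, 4), (4, 1), (5, 1), (0, 6)), ((3, 5), (4, 2), (5, 0), (0, 6)),
      ((1, 2), (3, 2), (4, 3), (0, 6)), ((2, 0), (3, 1), (5, 4), (0, 6)),
      ((1, 3), (4, 0), (5, 2), (0, 6)), ((1, 0), (2, 3), (5, 5), (0, 6))]"
  by (simp add: base_ok_simps)

lemma base_inner_7: "base_ok 7 7 3 0 6
     [((1, 4), (3, 3), (4, 4), (0, 0)), ((3, 1), (5, 5), (6, 4), (0, 3)),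
      ((2, 0), (3, 5), (5, 5), (0, 0)), ((3, 3), (5, 4), (6, 0), (0, 3)),
      ((1, 3), (2, 3), (5, 2), (0, 3)), ((2, 2), (4, 4), (6, 1), (0, 3)),
      ((3, 4), (4, 2), (6, 5), (0, 3)), ((2, 3), (5, 1), (6, 4), (0, 0)),
      ((1, 1), (2, 0), (3, 0), (0, 3)), ((2, 5), (3, 2), (4, 0), (0, 0)),
      ((1, 2), (5, 2), (6, 3), (0, 0)), ((1, 1), (3, 1), (6, 0), (0, 0))]"
  by (simp add: base_ok_simps)

lemma base_outer_7: "base_ok 7 7 3 6 9
     [((2, 0), (3, 0), (6, 4), (0, 6)), ((1, 1), (4, 1), (5, 0), (0, 6)),
      ((2, 3), (3, 2), (4, 0), (0, 6)), ((1, 2), (3, 1), (4, 5), (0, 6)),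
      ((2, 2), (4, 2), (6, 0), (0, 6)), ((2, 1), (3, 4), (4, 3), (0, 6)),
      ((3, 5), (5, 1), (6, 3), (0, 6)), ((2, 5), (4, 4), (5, 2), (0, 6)),
      ((1, 3), (2, 4), (6, 2), (0, 6)), ((1, 4), (5, 4), (6, 1), (0, 6)),
      ((1, 0), (5, 5), (6, 5), (0, 6)), ((1, 5), (3, 3), (5, 3), (0, 6))]"
  by (simp add: base_ok_simps)

lemma base_inner_8: "base_ok 8 7 3 0 6
     [((2, 3), (3, 3), (5, 5), (0, 0)), ((2, 3), (3, 1), (6, 3), (0, 3)),
      ((1, 5), (5, 4), (6, 5), (0, 0)), ((1, 4), (3, 0), (6, 0), (0, 3)),
      ((3, 5), (4, 1), (7, 3), (0, 3)), ((1, 2), (5, 3), (7, 5), (0, 0)),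
      ((5, 2), (6, 3), (7, 3), (0, 0)), ((0, 4), (5, 2), (6, 5), (7, 3)),
      ((1, 2), (4, 3), (7, 2), (0, 3)), ((2, 4), (4, 5), (5, 2), (0, 3)),
      ((2, 5), (6, 2), (7, 0), (0, 3)), ((1, 5), (3, 2), (4, 2), (0, 3)),
      ((2, 5), (4, 0), (7, 2), (0, 0)), ((0, 0), (1, 5), (6, 2), (7, 0)),
      ((2, 2), (4, 1), (5, 0), (0, 0)), ((1, 1), (3, 1), (6, 0), (0, 0))]"
  by (simp add: base_ok_simps)

lemma base_outer_8: "base_ok 8 7 3 6 9
     [((0, 0), (1, 4), (6, 3), (7, 6)), ((0, 1), (1, 2), (2, 5), (7, 6)),
      ((2, 4), (3, 0), (6, 0), (0, 6)), ((1, 2), (4, 1), (6, 2), (0, 6)),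
      ((2, 3), (5, 1), (6, 1), (0, 6)), ((2, 1), (4, 0), (7, 0), (0, 6)),
      ((1, 0), (2, 2), (7, 3), (0, 6)), ((1, 1), (5, 0), (6, 5), (0, 6)),
      ((1, 3), (4, 2), (7, 4), (0, 6)), ((1, 4), (3, 2), (5, 4), (0, 6)),
      ((3, 1), (6, 4), (7, 2), (0, 6)), ((3, 5), (4, 4), (5, 2), (0, 6)),
      ((2, 0), (4, 3), (6, 3), (0, 6)), ((1, 5), (2, 5), (5, 3), (0, 6)),
      ((3, 3), (5, 5), (7, 5), (0, 6)), ((3, 4), (4, 5), (7, 1), (0, 6))]"
  by (simp add: base_ok_simps)

lemma base_inner_9: "base_ok 9 9 3 0 6
     [((3, 0), (6, 1), (8, 1), (0, 3)), ((3, 2), (6, 4), (8, 1), (0, 0)),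
      ((3, 4), (4, 1), (5, 0), (0, 3)), ((2, 1), (4, 0), (8, 4), (0, 0)),
      ((2, 3), (5, 2), (8, 2), (0, 3)), ((1, 1), (6, 5), (7, 3), (0, 0)),
      ((3, 1), (4, 1), (8, 3), (0, 0)), ((1, 3), (2, 3), (7, 0), (0, 0)),
      ((2, 2), (3, 5), (7, 2), (0, 3)), ((4, 2), (5, 4), (6, 0), (0, 3)),
      ((6, 0), (7, 1), (8, 5), (0, 0)), ((1, 0), (3, 4), (4, 2), (0, 0)),
      ((3, 3), (5, 1), (7, 4), (0, 3)), ((2, 5), (5, 3), (7, 5), (0, 0)),
      ((1, 5), (2, 4), (4, 4), (0, 3)), ((1, 3), (4, 3), (8, 5), (0, 3))]"
  by (simp add: base_ok_simps)

lemma base_outer_9: "base_ok 9 9 3 6 9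
     [((1, 4), (3, 5), (7, 4), (0, 6)), ((1, 1), (2, 3), (6, 3), (0, 6)),
      ((1, 5), (2, 5), (7, 2), (0, 6)), ((2, 4), (4, 3), (7, 0), (0, 6)),
      ((1, 0), (3, 3), (8, 5), (0, 6)), ((3, 2), (5, 4), (8, 3), (0, 6)),
      ((5, 3), (6, 5), (7, 3), (0, 6)), ((1, 3), (4, 4), (6, 1), (0, 6)),
      ((3, 0), (6, 4), (7, 1), (0, 6)), ((3, 4), (4, 0), (5, 0), (0, 6)),
      ((3, 1), (4, 5), (8, 2), (0, 6)), ((5, 1), (6, 2), (7, 5), (0, 6)),
      ((2, 0), (5, 2), (8, 4), (0, 6)), ((5, 5), (6, 0), (8, 0), (0, 6)),
      ((2, 2), (4, 1), (8, 1), (0, 6)), ((1, 2), (2, 1), (4, 2), (0, 6))]"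
  by (simp add: base_ok_simps)

lemma base_inner_10: "base_ok 10 9 3 0 6
     [((1, 5), (2, 5), (5, 1), (0, 3)), ((2, 0), (5, 3), (8, 3), (0, 3)),
      ((4, 1), (6, 3), (8, 3), (0, 0)), ((3, 5), (7, 2), (8, 5), (0, 3)),
      ((5, 5), (7, 4), (9, 2), (0, 0)), ((2, 5), (3, 4), (9, 5), (0, 0)),
      ((3, 4), (8, 0), (9, 3), (0, 3)), ((0, 4), (2, 5), (4, 2), (9, 3)),
      ((7, 1), (8, 2), (9, 3), (0, 0)), ((4, 3), (5, 1), (7, 5), (0, 0)),
      ((3, 3), (4, 4), (7, 5), (0, 3)), ((1, 0), (3, 3), (8, 5), (0, 0)),
      ((4, 5), (6, 1), (9, 1), (0, 3)), ((1, 2), (3, 2), (4, 4), (0, 0)),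
      ((1, 5), (4, 0), (6, 2), (0, 0)), ((0, 0), (7, 2), (8, 3), (9, 0)),
      ((3, 1), (4, 0), (9, 2), (0, 3)), ((1, 2), (4, 2), (7, 0), (0, 3)),
      ((2, 3), (3, 2), (8, 2), (0, 3)), ((2, 0), (3, 0), (7, 2), (0, 0))]"
  by (simp add: base_ok_simps)

lemma base_outer_10: "base_ok 10 9 3 6 9
     [((0, 0), (4, 4), (5, 5), (9, 6)), ((0, 3), (2, 1), (6, 2), (9, 6)),
      ((4, 0), (5, 0), (8, 0), (0, 6)), ((1, 0), (6, 1), (8, 1), (0, 6)),
      ((1, 5), (2, 1), (8, 2), (0, 6)), ((4, 1), (5, 3), (7, 2), (0, 6)),
      ((5, 1), (6, 0), (8, 4), (0, 6)), ((1, 1), (3, 2), (9, 4), (0, 6)),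
      ((1, 2), (2, 0), (7, 4), (0, 6)), ((2, 2), (4, 4), (5, 4), (0, 6)),
      ((2, 5), (5, 2), (6, 3), (0, 6)), ((3, 3), (6, 5), (7, 0), (0, 6)),
      ((3, 1), (7, 3), (9, 1), (0, 6)), ((1, 3), (4, 2), (9, 0), (0, 6)),
      ((2, 3), (3, 0), (9, 2), (0, 6)), ((2, 4), (7, 1), (9, 5), (0, 6)),
      ((4, 5), (6, 2), (7, 5), (0, 6)), ((3, 5), (5, 5), (8, 3), (0, 6)),
      ((1, 4), (6, 4), (8, 5), (0, 6)), ((3, 4), (4, 3), (9, 3), (0, 6))]"
  by (simp add: base_ok_simps)

lemma base_inner_11: "base_ok 11 11 3 0 6
     [((1, 1), (7, 1), (8, 4), (0, 0)), ((4, 3), (6, 0), (8, 1), (0, 0)),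
      ((8, 2), (9, 0), (10, 5), (0, 0)), ((1, 0), (6, 2), (10, 4), (0, 0)),
      ((1, 3), (2, 2), (6, 1), (0, 0)), ((5, 3), (8, 0), (9, 4), (0, 0)),
      ((3, 3), (4, 1), (7, 5), (0, 0)), ((4, 0), (6, 4), (7, 3), (0, 0)),
      ((3, 5), (6, 3), (9, 2), (0, 0)), ((3, 4), (5, 5), (10, 1), (0, 0)),
      ((1, 0), (3, 0), (8, 4), (0, 3)), ((2, 0), (4, 2), (5, 1), (0, 3)),
      ((2, 1), (6, 2), (9, 1), (0, 3)), ((1, 4), (9, 2), (10, 2), (0, 3)),
      ((4, 3), (7, 1), (10, 1), (0, 3)), ((2, 5), (5, 4), (7, 2), (0, 3)),
      ((2, 4), (3, 1), (9, 0), (0, 3)), ((4, 5), (5, 5), (7, 5), (0, 3)),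
      ((2, 3), (3, 4), (8, 3), (0, 3)), ((1, 5), (6, 3), (10, 3), (0, 3))]"
  by (simp add: base_ok_simps)

lemma base_outer_11: "base_ok 11 11 3 6 9
     [((1, 3), (6, 1), (8, 5), (0, 6)), ((4, 3), (5, 1), (10, 5), (0, 6)),
      ((1, 4), (3, 2), (10, 4), (0, 6)), ((3, 0), (5, 3), (10, 3), (0, 6)),
      ((6, 5), (9, 4), (10, 1), (0, 6)), ((2, 3), (4, 2), (5, 4), (0, 6)),
      ((2, 5), (7, 4), (9, 5), (0, 6)), ((1, 0), (3, 5), (4, 5), (0, 6)),
      ((3, 3), (4, 4), (6, 3), (0, 6)), ((3, 4), (7, 3), (10, 2), (0, 6)),
      ((1, 5), (2, 4), (8, 1), (0, 6)), ((1, 2), (5, 5), (8, 2), (0, 6)),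
      ((3, 1), (5, 0), (6, 4), (0, 6)), ((2, 1), (8, 4), (9, 0), (0, 6)),
      ((4, 1), (8, 0), (9, 3), (0, 6)), ((7, 5), (9, 2), (10, 0), (0, 6)),
      ((2, 2), (5, 2), (8, 3), (0, 6)), ((6, 0), (7, 0), (9, 1), (0, 6)),
      ((2, 0), (4, 0), (7, 2), (0, 6)), ((1, 1), (6, 2), (7, 1), (0, 6))]"
  by (simp add: base_ok_simps)

lemma base_inner_12: "base_ok 12 11 3 0 6
     [((2, 1), (7, 2), (11, 4), (0, 0)), ((5, 3), (6, 5), (11, 3), (0, 0)),
      ((2, 5), (3, 0), (11, 4), (0, 3)), ((0, 3), (9, 4), (10, 1), (11, 3)),
      ((3, 3), (7, 3), (10, 1), (0, 3)), ((2, 4), (8, 4), (10, 2), (0, 3)),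
      ((3, 4), (5, 4), (6, 0), (0, 0)), ((1, 3), (4, 5), (10, 2), (0, 0)),
      ((1, 2), (7, 5), (10, 5), (0, 0)), ((3, 5), (10, 3), (11, 0), (0, 0)),
      ((2, 5), (7, 0), (10, 4), (0, 0)), ((5, 4), (9, 2), (10, 5), (0, 3)),
      ((2, 2), (4, 4), (9, 3), (0, 3)), ((2, 3), (8, 1), (9, 5), (0, 0)),
      ((4, 0), (6, 3), (11, 2), (0, 3)), ((3, 4), (4, 5), (5, 5), (0, 3)),
      ((1, 5), (4, 2), (6, 1), (0, 3)), ((1, 3), (3, 2), (7, 2), (0, 3)),
      ((2, 0), (3, 0), (6, 3), (0, 0)), ((0, 1), (4, 5), (8, 2), (11, 0)),
      ((5, 2), (8, 0), (11, 0), (0, 3)), ((2, 0), (3, 1), (7, 0), (0, 3)),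
      ((6, 1), (8, 2), (9, 1), (0, 0)), ((4, 2), (6, 2), (10, 0), (0, 0))]"
  by (simp add: base_ok_simps)

lemma base_outer_12: "base_ok 12 11 3 6 9
     [((0, 0), (4, 3), (6, 2), (11, 6)), ((0, 1), (3, 4), (8, 5), (11, 6)),
      ((2, 0), (4, 0), (8, 1), (0, 6)), ((1, 0), (2, 4), (9, 0), (0, 6)),
      ((3, 2), (8, 2), (9, 4), (0, 6)), ((2, 2), (6, 2), (7, 5), (0, 6)),
      ((4, 2), (5, 2), (10, 3), (0, 6)), ((5, 1), (7, 2), (11, 4), (0, 6)),
      ((7, 4), (8, 0), (9, 1), (0, 6)), ((4, 1), (5, 0), (11, 1), (0, 6)),
      ((1, 1), (8, 4), (10, 2), (0, 6)), ((3, 5), (7, 1), (10, 0), (0, 6)),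
      ((3, 1), (6, 3), (7, 0), (0, 6)), ((3, 4), (6, 1), (9, 2), (0, 6)),
      ((1, 2), (3, 3), (4, 3), (0, 6)), ((5, 4), (7, 3), (10, 1), (0, 6)),
      ((1, 3), (2, 1), (11, 5), (0, 6)), ((3, 0), (5, 3), (10, 5), (0, 6)),
      ((6, 0), (8, 5), (11, 2), (0, 6)), ((2, 5), (4, 5), (9, 5), (0, 6)),
      ((5, 5), (6, 4), (11, 0), (0, 6)), ((1, 4), (4, 4), (8, 3), (0, 6)),
      ((6, 5), (9, 3), (11, 3), (0, 6)), ((1, 5), (2, 3), (10, 4), (0, 6))]"
  by (simp add: base_ok_simps)

text \<open>Both lists for 13 have a further symmetry: multiplying the indices by 3, which has order
  3 modulo 13, permutes the base blocks in consecutive triples and leaves the labels alone.\<close>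

lemma base_inner_13: "base_ok 13 13 3 0 6
     [((1, 5), (2, 5), (10, 1), (0, 3)), ((3, 5), (6, 5), (4, 1), (0, 3)),
      ((9, 5), (5, 5), (12, 1), (0, 3)), ((2, 4), (4, 5), (7, 4), (0, 0)),
      ((6, 4), (12, 5), (8, 4), (0, 0)), ((5, 4), (10, 5), (11, 4), (0, 0)),
      ((1, 0), (6, 3), (12, 5), (0, 3)), ((3, 0), (5, 3), (10, 5), (0, 3)),
      ((9, 0), (2, 3), (4, 5), (0, 3)), ((1, 3), (7, 0), (11, 1), (0, 3)),
      ((3, 3), (8, 0), (7, 1), (0, 3)), ((9, 3), (11, 0), (8, 1), (0, 3)),
      ((2, 0), (5, 1), (8, 5), (0, 3)), ((6, 0), (2, 1), (11, 5), (0, 3)),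
      ((5, 0), (6, 1), (7, 5), (0, 3)), ((1, 3), (6, 2), (10, 4), (0, 0)),
      ((3, 3), (5, 2), (4, 4), (0, 0)), ((9, 3), (2, 2), (12, 4), (0, 0)),
      ((1, 4), (5, 1), (10, 1), (0, 0)), ((3, 4), (2, 1), (4, 1), (0, 0)),
      ((9, 4), (6, 1), (12, 1), (0, 0)), ((1, 0), (3, 1), (5, 0), (0, 0)),
      ((3, 0), (9, 1), (2, 0), (0, 0)), ((9, 0), (1, 1), (6, 0), (0, 0))]"
  by (simp add: base_ok_simps)

lemma base_outer_13: "base_ok 13 13 3 6 9
     [((1, 3), (3, 5), (11, 5), (0, 6)), ((3, 3), (9, 5), (7, 5), (0, 6)),
      ((9, 3), (1, 5), (8, 5), (0, 6)), ((1, 4), (5, 4), (9, 2), (0, 6)),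
      ((3, 4), (2, 4), (1, 2), (0, 6)), ((9, 4), (6, 4), (3, 2), (0, 6)),
      ((2, 2), (4, 5), (8, 3), (0, 6)), ((6, 2), (12, 5), (11, 3), (0, 6)),
      ((5, 2), (10, 5), (7, 3), (0, 6)), ((2, 3), (8, 4), (12, 0), (0, 6)),
      ((6, 3), (11, 4), (10, 0), (0, 6)), ((5, 3), (7, 4), (4, 0), (0, 6)),
      ((2, 5), (4, 1), (11, 2), (0, 6)), ((6, 5), (12, 1), (7, 2), (0, 6)),
      ((5, 5), (10, 1), (8, 2), (0, 6)), ((2, 0), (5, 1), (12, 4), (0, 6)),
      ((6, 0), (2, 1), (10, 4), (0, 6)), ((5, 0), (6, 1), (4, 4), (0, 6)),
      ((1, 1), (8, 1), (12, 3), (0, 6)), ((3, 1), (11, 1), (10, 3), (0, 6)),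
      ((9, 1), (7, 1), (4, 3), (0, 6)), ((1, 0), (11, 0), (12, 2), (0, 6)),
      ((3, 0), (7, 0), (10, 2), (0, 6)), ((9, 0), (8, 0), (4, 2), (0, 6))]"
  by (simp add: base_ok_simps)

lemma base_inner_14: "base_ok 14 13 3 0 6
     [((7, 5), (12, 0), (13, 2), (0, 0)), ((0, 4), (2, 2), (3, 5), (13, 0)),
      ((1, 2), (11, 4), (13, 0), (0, 0)), ((1, 5), (12, 0), (13, 0), (0, 3)),
      ((4, 0), (8, 0), (12, 2), (0, 0)), ((4, 0), (9, 4), (10, 0), (0, 3)),
      ((5, 0), (8, 0), (12, 1), (0, 3)), ((4, 2), (6, 2), (10, 5), (0, 0)),
      ((4, 2), (5, 2), (7, 5), (0, 3)), ((8, 1), (9, 3), (11, 0), (0, 3)),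
      ((1, 4), (2, 2), (12, 5), (0, 0)), ((2, 1), (3, 5), (7, 1), (0, 3)),
      ((1, 4), (3, 0), (10, 2), (0, 3)), ((3, 1), (12, 3), (13, 4), (0, 0)),
      ((6, 3), (11, 2), (13, 3), (0, 0)), ((5, 1), (6, 2), (10, 3), (0, 3)),
      ((5, 2), (11, 3), (12, 4), (0, 0)), ((7, 0), (9, 2), (10, 1), (0, 0)),
      ((7, 3), (11, 0), (13, 5), (0, 0)), ((4, 4), (5, 1), (10, 0), (0, 0)),
      ((3, 5), (6, 1), (9, 5), (0, 0)), ((1, 3), (9, 0), (11, 1), (0, 3)),
      ((5, 4), (6, 4), (10, 4), (0, 0)), ((4, 4), (6, 5), (11, 2), (0, 3)),
      ((3, 4), (9, 1), (11, 5), (0, 3)), ((5, 3), (7, 3), (11, 4), (0, 3)),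
      ((5, 4), (8, 4), (11, 3), (0, 3)), ((0, 3), (1, 5), (9, 4), (13, 3))]"
  by (simp add: base_ok_simps)

lemma base_outer_14: "base_ok 14 13 3 6 9
     [((0, 3), (2, 2), (7, 5), (13, 6)), ((0, 0), (3, 1), (10, 4), (13, 6)),
      ((3, 3), (7, 3), (9, 3), (0, 6)), ((4, 2), (10, 3), (11, 3), (0, 6)),
      ((3, 5), (4, 0), (12, 3), (0, 6)), ((6, 5), (9, 4), (11, 5), (0, 6)),
      ((1, 5), (2, 4), (5, 1), (0, 6)), ((4, 3), (5, 2), (9, 5), (0, 6)),
      ((5, 4), (7, 2), (10, 5), (0, 6)), ((1, 4), (4, 5), (13, 4), (0, 6)),
      ((1, 3), (7, 1), (8, 4), (0, 6)), ((6, 1), (8, 3), (12, 4), (0, 6)),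
      ((1, 0), (2, 5), (4, 4), (0, 6)), ((3, 1), (5, 5), (8, 5), (0, 6)),
      ((2, 0), (6, 4), (7, 5), (0, 6)), ((2, 3), (3, 0), (13, 2), (0, 6)),
      ((6, 3), (11, 2), (13, 0), (0, 6)), ((5, 3), (8, 1), (13, 1), (0, 6)),
      ((1, 2), (10, 4), (12, 1), (0, 6)), ((1, 1), (3, 4), (10, 2), (0, 6)),
      ((2, 1), (8, 2), (11, 4), (0, 6)), ((8, 0), (12, 5), (13, 3), (0, 6)),
      ((6, 0), (7, 4), (12, 2), (0, 6)), ((3, 2), (4, 1), (9, 2), (0, 6)),
      ((5, 0), (7, 0), (10, 0), (0, 6)), ((2, 2), (6, 2), (11, 1), (0, 6)),
      ((9, 0), (10, 1), (13, 5), (0, 6)), ((9, 1), (11, 0), (12, 0), (0, 6))]"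
  by (simp add: base_ok_simps)

lemma base_inner_15: "base_ok 15 15 3 0 6
     [((4, 4), (7, 5), (11, 2), (0, 0)), ((8, 4), (9, 3), (14, 3), (0, 3)),
      ((3, 2), (11, 3), (13, 3), (0, 3)), ((1, 3), (2, 2), (5, 5), (0, 0)),
      ((4, 5), (9, 4), (10, 5), (0, 0)), ((1, 0), (10, 4), (12, 5), (0, 3)),
      ((5, 4), (7, 3), (12, 1), (0, 3)), ((2, 4), (6, 0), (8, 5), (0, 0)),
      ((4, 3), (10, 0), (14, 5), (0, 0)), ((7, 0), (12, 5), (13, 5), (0, 0)),
      ((6, 5), (13, 4), (14, 2), (0, 0)), ((1, 4), (10, 0), (13, 4), (0, 3)),
      ((7, 4), (9, 2), (11, 5), (0, 3)), ((7, 3), (10, 1), (11, 3), (0, 0)),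
      ((2, 4), (5, 3), (8, 2), (0, 3)), ((3, 0), (6, 5), (14, 1), (0, 3)),
      ((3, 5), (11, 4), (13, 1), (0, 3)), ((4, 1), (7, 2), (14, 4), (0, 3)),
      ((5, 2), (9, 5), (10, 2), (0, 3)), ((3, 3), (10, 3), (13, 0), (0, 0)),
      ((1, 2), (2, 0), (3, 3), (0, 3)), ((8, 1), (9, 5), (11, 1), (0, 0)),
      ((2, 3), (11, 0), (13, 2), (0, 0)), ((4, 2), (9, 0), (12, 2), (0, 3)),
      ((6, 0), (7, 0), (14, 2), (0, 3)), ((1, 0), (6, 2), (7, 1), (0, 0)),
      ((6, 1), (10, 2), (12, 0), (0, 0)), ((1, 2), (3, 2), (12, 2), (0, 0))]"
  by (simp add: base_ok_simps)

lemma base_outer_15: "base_ok 15 15 3 6 9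
     [((1, 2), (3, 3), (12, 3), (0, 6)), ((8, 0), (12, 5), (13, 5), (0, 6)),
      ((3, 5), (7, 2), (10, 3), (0, 6)), ((7, 4), (10, 5), (11, 4), (0, 6)),
      ((4, 4), (6, 4), (8, 3), (0, 6)), ((2, 3), (3, 1), (7, 5), (0, 6)),
      ((3, 4), (5, 2), (9, 5), (0, 6)), ((9, 3), (11, 0), (14, 3), (0, 6)),
      ((4, 3), (9, 0), (11, 5), (0, 6)), ((2, 4), (5, 4), (14, 2), (0, 6)),
      ((6, 5), (13, 2), (14, 5), (0, 6)), ((1, 3), (2, 2), (4, 5), (0, 6)),
      ((3, 2), (8, 5), (14, 4), (0, 6)), ((1, 4), (2, 5), (10, 0), (0, 6)),
      ((6, 1), (7, 3), (12, 4), (0, 6)), ((4, 2), (11, 3), (13, 4), (0, 6)),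
      ((1, 5), (5, 3), (8, 1), (0, 6)), ((6, 3), (8, 2), (11, 1), (0, 6)),
      ((1, 1), (10, 4), (13, 0), (0, 6)), ((7, 0), (8, 4), (14, 0), (0, 6)),
      ((5, 5), (6, 2), (10, 1), (0, 6)), ((4, 0), (9, 4), (12, 1), (0, 6)),
      ((5, 1), (6, 0), (13, 3), (0, 6)), ((9, 2), (12, 2), (14, 1), (0, 6)),
      ((4, 1), (9, 1), (13, 1), (0, 6)), ((2, 1), (11, 2), (12, 0), (0, 6)),
      ((1, 0), (2, 0), (10, 2), (0, 6)), ((3, 0), (5, 0), (7, 1), (0, 6))]"
  by (simp add: base_ok_simps)

lemma base_inner_16: "base_ok 16 15 3 0 6
     [((7, 0), (11, 3), (15, 2), (0, 0)), ((0, 0), (2, 2), (4, 5), (15, 0)),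
      ((6, 0), (14, 2), (15, 0), (0, 3)), ((4, 4), (13, 5), (15, 2), (0, 3)),
      ((3, 5), (8, 1), (10, 5), (0, 0)), ((1, 1), (4, 1), (11, 0), (0, 0)),
      ((1, 4), (8, 1), (9, 1), (0, 3)), ((1, 2), (7, 1), (13, 1), (0, 0)),
      ((3, 2), (4, 1), (8, 2), (0, 3)), ((1, 1), (2, 5), (3, 1), (0, 3)),
      ((3, 0), (9, 5), (10, 0), (0, 3)), ((2, 0), (4, 5), (5, 5), (0, 0)),
      ((7, 5), (9, 2), (14, 1), (0, 3)), ((5, 1), (8, 4), (9, 1), (0, 0)),
      ((2, 3), (9, 4), (12, 0), (0, 0)), ((2, 0), (11, 2), (12, 5), (0, 3)),
      ((5, 0), (9, 2), (15, 4), (0, 0)), ((4, 3), (12, 1), (13, 2), (0, 0)),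
      ((2, 4), (7, 3), (11, 1), (0, 0)), ((2, 1), (4, 2), (7, 3), (0, 3)),
      ((1, 0), (10, 4), (15, 3), (0, 0)), ((3, 1), (6, 0), (13, 4), (0, 0)),
      ((1, 3), (5, 2), (10, 3), (0, 0)), ((3, 4), (5, 4), (8, 5), (0, 0)),
      ((6, 1), (10, 5), (14, 3), (0, 3)), ((3, 3), (8, 3), (14, 4), (0, 0)),
      ((0, 3), (8, 4), (14, 1), (15, 3)), ((10, 4), (11, 3), (13, 1), (0, 3)),
      ((1, 0), (12, 3), (14, 4), (0, 3)), ((3, 5), (6, 5), (9, 0), (0, 3)),
      ((11, 4), (13, 3), (15, 4), (0, 3)), ((5, 3), (8, 5), (9, 3), (0, 3))]"
  by (simp add: base_ok_simps)

lemma base_outer_16: "base_ok 16 15 3 6 9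
     [((0, 0), (1, 3), (6, 2), (15, 6)), ((0, 1), (13, 5), (14, 4), (15, 6)),
      ((5, 2), (8, 5), (14, 5), (0, 6)), ((4, 1), (7, 5), (11, 5), (0, 6)),
      ((4, 4), (6, 4), (13, 2), (0, 6)), ((1, 4), (4, 3), (14, 3), (0, 6)),
      ((2, 3), (4, 5), (9, 3), (0, 6)), ((7, 4), (8, 4), (14, 0), (0, 6)),
      ((5, 5), (11, 4), (15, 0), (0, 6)), ((1, 1), (9, 4), (13, 3), (0, 6)),
      ((2, 1), (12, 4), (13, 5), (0, 6)), ((3, 3), (10, 4), (13, 4), (0, 6)),
      ((2, 5), (11, 2), (14, 4), (0, 6)), ((1, 0), (5, 3), (12, 5), (0, 6)),
      ((1, 3), (3, 1), (5, 4), (0, 6)), ((3, 4), (11, 1), (12, 3), (0, 6)),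
      ((5, 0), (10, 3), (12, 0), (0, 6)), ((2, 0), (6, 5), (10, 2), (0, 6)),
      ((3, 5), (8, 0), (15, 2), (0, 6)), ((3, 0), (9, 1), (10, 5), (0, 6)),
      ((11, 3), (12, 1), (14, 2), (0, 6)), ((2, 4), (12, 2), (15, 5), (0, 6)),
      ((1, 5), (4, 2), (15, 4), (0, 6)), ((7, 1), (9, 5), (10, 1), (0, 6)),
      ((1, 2), (6, 3), (15, 3), (0, 6)), ((2, 2), (6, 1), (8, 3), (0, 6)),
      ((3, 2), (7, 3), (13, 1), (0, 6)), ((6, 0), (10, 0), (11, 0), (0, 6)),
      ((4, 0), (7, 2), (14, 1), (0, 6)), ((7, 0), (9, 2), (13, 0), (0, 6)),
      ((8, 1), (9, 0), (15, 1), (0, 6)), ((5, 1), (6, 2), (8, 2), (0, 6))]"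
  by (simp add: base_ok_simps)

lemma base_inner_17: "base_ok 17 17 3 0 6
     [((5, 1), (10, 0), (13, 2), (0, 3)), ((2, 4), (5, 0), (7, 1), (0, 0)),
      ((1, 2), (2, 2), (3, 5), (0, 0)), ((3, 1), (14, 0), (15, 1), (0, 3)),
      ((3, 1), (6, 1), (11, 3), (0, 0)), ((2, 3), (8, 2), (13, 0), (0, 0)),
      ((1, 5), (2, 2), (11, 0), (0, 3)), ((3, 2), (13, 1), (16, 2), (0, 3)),
      ((12, 3), (14, 0), (16, 2), (0, 0)), ((7, 5), (8, 1), (13, 5), (0, 0)),
      ((6, 5), (7, 0), (9, 0), (0, 0)), ((6, 2), (13, 2), (16, 4), (0, 0)),
      ((2, 0), (6, 4), (11, 0), (0, 0)), ((9, 4), (11, 5), (13, 1), (0, 0)),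
      ((2, 5), (8, 0), (12, 1), (0, 3)), ((1, 0), (7, 4), (14, 1), (0, 0)),
      ((3, 0), (5, 4), (9, 2), (0, 3)), ((4, 3), (9, 1), (16, 0), (0, 3)),
      ((2, 1), (10, 5), (11, 4), (0, 0)), ((7, 0), (11, 5), (13, 0), (0, 3)),
      ((3, 4), (12, 1), (15, 5), (0, 0)), ((4, 0), (5, 2), (15, 3), (0, 3)),
      ((9, 5), (12, 2), (16, 5), (0, 0)), ((7, 2), (8, 3), (16, 3), (0, 0)),
      ((1, 5), (5, 3), (13, 4), (0, 0)), ((1, 4), (4, 4), (12, 2), (0, 3)),
      ((7, 2), (8, 4), (14, 5), (0, 3)), ((2, 0), (4, 5), (5, 3), (0, 3)),
      ((2, 4), (7, 4), (9, 3), (0, 3)), ((3, 5), (6, 3), (10, 3), (0, 3)),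
      ((7, 5), (8, 5), (11, 4), (0, 3)), ((5, 5), (14, 3), (16, 3), (0, 3))]"
  by (simp add: base_ok_simps)

lemma base_outer_17: "base_ok 17 17 3 6 9
     [((4, 2), (8, 2), (15, 3), (0, 6)), ((9, 0), (11, 1), (12, 2), (0, 6)),
      ((7, 1), (10, 3), (14, 2), (0, 6)), ((11, 0), (13, 2), (16, 2), (0, 6)),
      ((2, 2), (13, 1), (15, 4), (0, 6)), ((12, 0), (13, 0), (14, 5), (0, 6)),
      ((2, 1), (5, 4), (12, 1), (0, 6)), ((2, 3), (3, 2), (11, 2), (0, 6)),
      ((5, 0), (8, 1), (10, 5), (0, 6)), ((5, 2), (7, 2), (16, 4), (0, 6)),
      ((3, 0), (9, 4), (14, 1), (0, 6)), ((4, 3), (6, 1), (10, 0), (0, 6)),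
      ((6, 0), (10, 1), (14, 3), (0, 6)), ((7, 0), (12, 4), (16, 1), (0, 6)),
      ((4, 1), (7, 5), (9, 1), (0, 6)), ((9, 2), (13, 5), (15, 2), (0, 6)),
      ((1, 1), (8, 0), (9, 3), (0, 6)), ((8, 3), (15, 1), (16, 0), (0, 6)),
      ((1, 0), (10, 2), (15, 5), (0, 6)), ((3, 1), (10, 4), (15, 0), (0, 6)),
      ((1, 2), (8, 4), (11, 3), (0, 6)), ((3, 5), (13, 3), (14, 0), (0, 6)),
      ((1, 5), (2, 0), (16, 3), (0, 6)), ((4, 0), (13, 4), (16, 5), (0, 6)),
      ((5, 1), (6, 5), (9, 5), (0, 6)), ((3, 3), (6, 2), (12, 5), (0, 6)),
      ((2, 5), (4, 5), (11, 5), (0, 6)), ((4, 4), (5, 5), (12, 3), (0, 6)),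
      ((6, 4), (7, 3), (11, 4), (0, 6)), ((3, 4), (8, 5), (14, 4), (0, 6)),
      ((1, 3), (5, 3), (7, 4), (0, 6)), ((1, 4), (2, 4), (6, 3), (0, 6))]"
  by (simp add: base_ok_simps)

lemma base_inner_18: "base_ok 18 17 3 0 6
     [((9, 4), (12, 1), (17, 3), (0, 3)), ((4, 1), (9, 2), (17, 5), (0, 3)),
      ((0, 1), (6, 5), (11, 2), (17, 3)), ((3, 5), (9, 3), (17, 3), (0, 0)),
      ((5, 3), (15, 2), (17, 2), (0, 3)), ((11, 1), (14, 5), (17, 0), (0, 3)),
      ((0, 0), (3, 1), (14, 5), (17, 0)), ((7, 0), (9, 4), (17, 1), (0, 0)),
      ((5, 4), (12, 5), (13, 3), (0, 0)), ((8, 3), (9, 0), (10, 4), (0, 0)),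
      ((3, 0), (4, 3), (15, 4), (0, 3)), ((10, 4), (13, 4), (14, 2), (0, 3)),
      ((3, 3), (5, 0), (16, 3), (0, 0)), ((1, 4), (8, 4), (16, 1), (0, 3)),
      ((1, 3), (4, 5), (7, 3), (0, 0)), ((9, 5), (10, 5), (11, 4), (0, 0)),
      ((8, 3), (10, 2), (12, 4), (0, 3)), ((1, 5), (5, 2), (13, 5), (0, 3)),
      ((3, 3), (4, 2), (15, 1), (0, 3)), ((6, 3), (11, 1), (14, 4), (0, 0)),
      ((1, 4), (11, 5), (16, 4), (0, 0)), ((3, 1), (5, 0), (12, 5), (0, 3)),
      ((2, 0), (3, 5), (7, 4), (0, 3)), ((2, 2), (6, 3), (11, 4), (0, 3)),
      ((6, 4), (13, 0), (15, 0), (0, 3)), ((7, 3), (9, 1), (15, 3), (0, 3)),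
      ((6, 0), (12, 0), (16, 3), (0, 3)), ((2, 1), (7, 0), (15, 5), (0, 3)),
      ((1, 1), (2, 2), (6, 4), (0, 0)), ((6, 0), (10, 2), (16, 5), (0, 0)),
      ((7, 5), (10, 1), (13, 0), (0, 0)), ((1, 2), (4, 4), (14, 1), (0, 0)),
      ((1, 0), (3, 1), (8, 1), (0, 0)), ((4, 1), (12, 2), (13, 1), (0, 0)),
      ((8, 2), (11, 2), (15, 2), (0, 0)), ((5, 2), (14, 0), (15, 0), (0, 0))]"
  by (simp add: base_ok_simps)

lemma base_outer_18: "base_ok 18 17 3 6 9
     [((0, 0), (5, 2), (14, 5), (17, 6)), ((0, 3), (6, 1), (13, 4), (17, 6)),
      ((1, 0), (3, 5), (5, 0), (0, 6)), ((4, 2), (9, 3), (10, 2), (0, 6)),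
      ((6, 0), (7, 0), (13, 5), (0, 6)), ((10, 5), (12, 1), (15, 1), (0, 6)),
      ((3, 0), (8, 5), (12, 0), (0, 6)), ((7, 2), (11, 0), (12, 5), (0, 6)),
      ((2, 2), (6, 4), (16, 0), (0, 6)), ((6, 1), (12, 2), (14, 0), (0, 6)),
      ((8, 1), (9, 4), (16, 2), (0, 6)), ((1, 2), (11, 2), (12, 3), (0, 6)),
      ((7, 1), (9, 0), (17, 4), (0, 6)), ((5, 1), (7, 4), (8, 2), (0, 6)),
      ((2, 0), (5, 5), (9, 1), (0, 6)), ((8, 0), (9, 2), (14, 2), (0, 6)),
      ((6, 2), (10, 1), (14, 4), (0, 6)), ((3, 1), (15, 0), (17, 1), (0, 6)),
      ((4, 0), (12, 4), (14, 1), (0, 6)), ((2, 1), (3, 2), (11, 5), (0, 6)),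
      ((9, 5), (13, 2), (15, 2), (0, 6)), ((4, 5), (11, 1), (15, 5), (0, 6)),
      ((2, 5), (5, 2), (7, 3), (0, 6)), ((10, 4), (13, 0), (17, 2), (0, 6)),
      ((1, 1), (7, 5), (13, 4), (0, 6)), ((3, 3), (10, 0), (17, 5), (0, 6)),
      ((3, 4), (4, 1), (16, 3), (0, 6)), ((2, 4), (5, 4), (16, 1), (0, 6)),
      ((5, 3), (13, 1), (16, 5), (0, 6)), ((1, 5), (10, 3), (17, 3), (0, 6)),
      ((13, 3), (14, 3), (15, 4), (0, 6)), ((8, 3), (16, 4), (17, 0), (0, 6)),
      ((1, 4), (2, 3), (4, 3), (0, 6)), ((6, 3), (11, 3), (15, 3), (0, 6)),
      ((1, 3), (6, 5), (8, 4), (0, 6)), ((4, 4), (11, 4), (14, 5), (0, 6))]"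
  by (simp add: base_ok_simps)

text \<open>As for 13, the base blocks of both lists come in consecutive triples, now under
  multiplication of the indices by 7, which has order 3 modulo 19.\<close>

lemma base_inner_19: "base_ok 19 19 3 0 6
     [((1, 1), (10, 2), (14, 2), (0, 0)), ((7, 1), (13, 2), (3, 2), (0, 0)),
      ((11, 1), (15, 2), (2, 2), (0, 0)), ((4, 0), (5, 0), (16, 5), (0, 3)),
      ((9, 0), (16, 0), (17, 5), (0, 3)), ((6, 0), (17, 0), (5, 5), (0, 3)),
      ((2, 1), (4, 1), (18, 3), (0, 3)), ((14, 1), (9, 1), (12, 3), (0, 3)),
      ((3, 1), (6, 1), (8, 3), (0, 3)), ((1, 1), (2, 0), (8, 5), (0, 3)),
      ((7, 1), (14, 0), (18, 5), (0, 3)), ((11, 1), (3, 0), (12, 5), (0, 3)),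
      ((2, 1), (4, 2), (14, 5), (0, 0)), ((14, 1), (9, 2), (3, 5), (0, 0)),
      ((3, 1), (6, 2), (2, 5), (0, 0)), ((1, 2), (12, 0), (16, 3), (0, 3)),
      ((7, 2), (8, 0), (17, 3), (0, 3)), ((11, 2), (18, 0), (5, 3), (0, 3)),
      ((1, 4), (4, 4), (17, 0), (0, 0)), ((7, 4), (9, 4), (5, 0), (0, 0)),
      ((11, 4), (6, 4), (16, 0), (0, 0)), ((1, 5), (10, 0), (18, 3), (0, 0)),
      ((7, 5), (13, 0), (12, 3), (0, 0)), ((11, 5), (15, 0), (8, 3), (0, 0)),
      ((1, 2), (6, 3), (18, 0), (0, 0)), ((7, 2), (4, 3), (12, 0), (0, 0)),
      ((11, 2), (9, 3), (8, 0), (0, 0)), ((1, 5), (14, 5), (17, 2), (0, 3)),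
      ((7, 5), (3, 5), (5, 2), (0, 3)), ((11, 5), (2, 5), (16, 2), (0, 3)),
      ((4, 5), (15, 4), (16, 4), (0, 0)), ((9, 5), (10, 4), (17, 4), (0, 0)),
      ((6, 5), (13, 4), (5, 4), (0, 0)), ((4, 3), (10, 4), (13, 5), (0, 3)),
      ((9, 3), (13, 4), (15, 5), (0, 3)), ((6, 3), (15, 4), (10, 5), (0, 3))]"
  by (simp add: base_ok_simps)

lemma base_outer_19: "base_ok 19 19 3 6 9
     [((1, 5), (13, 3), (17, 5), (0, 6)), ((7, 5), (15, 3), (5, 5), (0, 6)),
      ((11, 5), (10, 3), (16, 5), (0, 6)), ((1, 3), (8, 3), (14, 0), (0, 6)),
      ((7, 3), (18, 3), (3, 0), (0, 6)), ((11, 3), (12, 3), (2, 0), (0, 6)),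
      ((2, 5), (15, 1), (16, 4), (0, 6)), ((14, 5), (10, 1), (17, 4), (0, 6)),
      ((3, 5), (13, 1), (5, 4), (0, 6)), ((4, 2), (9, 5), (18, 5), (0, 6)),
      ((9, 2), (6, 5), (12, 5), (0, 6)), ((6, 2), (4, 5), (8, 5), (0, 6)),
      ((5, 0), (10, 4), (13, 5), (0, 6)), ((16, 0), (13, 4), (15, 5), (0, 6)),
      ((17, 0), (15, 4), (10, 5), (0, 6)), ((1, 2), (8, 4), (16, 3), (0, 6)),
      ((7, 2), (18, 4), (17, 3), (0, 6)), ((11, 2), (12, 4), (5, 3), (0, 6)),
      ((1, 4), (14, 3), (15, 2), (0, 6)), ((7, 4), (3, 3), (10, 2), (0, 6)),
      ((11, 4), (2, 3), (13, 2), (0, 6)), ((1, 0), (2, 4), (8, 2), (0, 6)),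
      ((7, 0), (14, 4), (18, 2), (0, 6)), ((11, 0), (3, 4), (12, 2), (0, 6)),
      ((4, 0), (6, 4), (16, 2), (0, 6)), ((9, 0), (4, 4), (17, 2), (0, 6)),
      ((6, 0), (9, 4), (5, 2), (0, 6)), ((1, 1), (4, 3), (15, 0), (0, 6)),
      ((7, 1), (9, 3), (10, 0), (0, 6)), ((11, 1), (6, 3), (13, 0), (0, 6)),
      ((2, 2), (8, 0), (18, 1), (0, 6)), ((14, 2), (18, 0), (12, 1), (0, 6)),
      ((3, 2), (12, 0), (8, 1), (0, 6)), ((2, 1), (5, 1), (6, 1), (0, 6)),
      ((14, 1), (16, 1), (4, 1), (0, 6)), ((3, 1), (17, 1), (9, 1), (0, 6))]"
  by (simp add: base_ok_simps)

text \<open>Six groups over the integers modulo 5 reach neither 23 nor 27: the excesses 3 and 7 over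
  \<open>4 * 5\<close> are not sums of two of the permitted sizes 0, 1, 4, 5. A seventh group would
  need 5 to be a unit modulo 5, and the next modulus coprime to 6 already gives
  \<open>4 * 7 = 28\<close>.\<close>

lemma base_inner_23: "base_ok 23 23 3 0 6
     [((4, 4), (5, 0), (16, 0), (0, 0)), ((5, 2), (18, 0), (19, 1), (0, 3)),
      ((4, 0), (9, 5), (21, 2), (0, 3)), ((3, 4), (10, 0), (13, 1), (0, 0)),
      ((1, 0), (9, 2), (16, 5), (0, 3)), ((2, 2), (9, 4), (17, 1), (0, 0)),
      ((1, 2), (18, 3), (22, 0), (0, 0)), ((11, 5), (17, 5), (20, 0), (0, 0)),
      ((2, 5), (8, 2), (17, 3), (0, 0)), ((2, 1), (8, 0), (11, 0), (0, 3)),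
      ((2, 0), (3, 0), (12, 0), (0, 3)), ((5, 5), (14, 2), (20, 4), (0, 0)),
      ((13, 2), (17, 0), (21, 2), (0, 0)), ((1, 4), (5, 4), (19, 1), (0, 0)),
      ((5, 5), (7, 1), (14, 1), (0, 3)), ((10, 1), (17, 0), (22, 0), (0, 3)),
      ((7, 2), (17, 5), (20, 1), (0, 3)), ((10, 4), (15, 2), (19, 4), (0, 0)),
      ((6, 4), (16, 2), (22, 5), (0, 0)), ((18, 1), (20, 2), (22, 4), (0, 0)),
      ((1, 1), (2, 0), (17, 4), (0, 0)), ((8, 5), (14, 3), (19, 0), (0, 0)),
      ((5, 1), (9, 1), (10, 5), (0, 3)), ((6, 5), (8, 0), (12, 4), (0, 0)),
      ((3, 2), (11, 4), (13, 3), (0, 0)), ((2, 4), (4, 1), (16, 2), (0, 3)),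
      ((10, 5), (11, 0), (13, 4), (0, 0)), ((4, 1), (6, 1), (9, 0), (0, 0)),
      ((7, 3), (11, 2), (21, 4), (0, 0)), ((9, 3), (10, 3), (16, 1), (0, 0)),
      ((14, 1), (15, 4), (20, 5), (0, 0)), ((5, 3), (15, 2), (20, 0), (0, 3)),
      ((11, 5), (15, 0), (22, 1), (0, 3)), ((12, 2), (15, 5), (18, 2), (0, 0)),
      ((16, 4), (20, 3), (21, 0), (0, 3)), ((11, 1), (18, 5), (22, 3), (0, 3)),
      ((1, 5), (16, 1), (19, 5), (0, 3)), ((19, 0), (20, 5), (22, 5), (0, 3)),
      ((7, 0), (9, 3), (19, 3), (0, 3)), ((8, 3), (11, 3), (21, 4), (0, 3)),
      ((4, 5), (15, 5), (16, 3), (0, 3)), ((6, 5), (11, 4), (13, 5), (0, 3)),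
      ((3, 5), (6, 3), (15, 4), (0, 3)), ((13, 3), (14, 5), (21, 3), (0, 3))]"
  by (simp add: base_ok_simps)

lemma base_outer_23: "base_ok 23 23 3 6 9
     [((2, 4), (6, 2), (8, 1), (0, 6)), ((3, 5), (6, 1), (13, 0), (0, 6)),
      ((1, 1), (3, 3), (12, 0), (0, 6)), ((1, 2), (6, 0), (9, 2), (0, 6)),
      ((11, 1), (15, 0), (17, 3), (0, 6)), ((7, 2), (17, 0), (20, 3), (0, 6)),
      ((12, 1), (15, 2), (19, 5), (0, 6)), ((14, 2), (17, 2), (21, 0), (0, 6)),
      ((6, 5), (18, 0), (22, 0), (0, 6)), ((2, 0), (4, 1), (14, 5), (0, 6)),
      ((5, 0), (8, 4), (19, 0), (0, 6)), ((8, 2), (16, 1), (19, 3), (0, 6)),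
      ((20, 1), (21, 5), (22, 1), (0, 6)), ((11, 2), (16, 2), (17, 1), (0, 6)),
      ((2, 1), (16, 0), (21, 4), (0, 6)), ((3, 1), (4, 4), (15, 1), (0, 6)),
      ((2, 2), (12, 4), (20, 0), (0, 6)), ((9, 1), (14, 4), (19, 1), (0, 6)),
      ((7, 5), (21, 1), (22, 2), (0, 6)), ((4, 0), (10, 4), (19, 2), (0, 6)),
      ((1, 0), (13, 2), (18, 4), (0, 6)), ((7, 1), (11, 3), (14, 1), (0, 6)),
      ((5, 2), (11, 0), (12, 5), (0, 6)), ((5, 1), (13, 3), (18, 2), (0, 6)),
      ((4, 2), (12, 3), (13, 1), (0, 6)), ((3, 2), (20, 2), (22, 3), (0, 6)),
      ((1, 3), (8, 0), (9, 0), (0, 6)), ((5, 4), (9, 5), (14, 0), (0, 6)),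
      ((3, 4), (10, 2), (14, 3), (0, 6)), ((7, 0), (16, 3), (22, 5), (0, 6)),
      ((7, 4), (10, 1), (20, 4), (0, 6)), ((4, 3), (16, 5), (18, 1), (0, 6)),
      ((9, 3), (10, 0), (21, 3), (0, 6)), ((1, 5), (3, 0), (20, 5), (0, 6)),
      ((4, 5), (11, 5), (21, 2), (0, 6)), ((5, 3), (10, 5), (12, 2), (0, 6)),
      ((7, 3), (13, 4), (22, 4), (0, 6)), ((16, 4), (17, 5), (18, 5), (0, 6)),
      ((6, 3), (11, 4), (19, 4), (0, 6)), ((2, 3), (5, 5), (8, 3), (0, 6)),
      ((8, 5), (15, 3), (18, 3), (0, 6)), ((1, 4), (6, 4), (15, 5), (0, 6)),
      ((2, 5), (9, 4), (10, 3), (0, 6)), ((13, 5), (15, 4), (17, 4), (0, 6))]"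
  by (simp add: base_ok_simps)

lemma base_inner_27: "base_ok 27 27 3 0 6
     [((12, 0), (13, 1), (16, 4), (0, 0)), ((6, 1), (16, 1), (18, 1), (0, 3)),
      ((3, 4), (11, 2), (19, 0), (0, 0)), ((18, 4), (19, 2), (26, 0), (0, 3)),
      ((2, 1), (15, 0), (23, 5), (0, 3)), ((1, 1), (4, 1), (7, 0), (0, 3)),
      ((12, 2), (17, 3), (21, 2), (0, 3)), ((1, 0), (3, 5), (23, 0), (0, 0)),
      ((13, 2), (20, 1), (25, 4), (0, 0)), ((1, 2), (5, 0), (16, 0), (0, 0)),
      ((3, 0), (20, 1), (24, 3), (0, 3)), ((14, 3), (15, 2), (25, 0), (0, 0)),
      ((5, 2), (10, 1), (19, 2), (0, 0)), ((16, 2), (18, 0), (22, 2), (0, 3)),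
      ((7, 3), (12, 0), (20, 2), (0, 3)), ((1, 1), (16, 3), (19, 3), (0, 0)),
      ((3, 3), (17, 0), (19, 4), (0, 0)), ((4, 5), (12, 5), (21, 1), (0, 0)),
      ((5, 5), (10, 3), (21, 2), (0, 0)), ((20, 4), (23, 2), (24, 2), (0, 0)),
      ((9, 0), (19, 5), (21, 1), (0, 3)), ((8, 2), (21, 0), (24, 1), (0, 0)),
      ((7, 4), (14, 0), (21, 0), (0, 3)), ((18, 2), (19, 1), (23, 4), (0, 3)),
      ((2, 4), (9, 2), (15, 5), (0, 0)), ((10, 1), (14, 1), (24, 4), (0, 3)),
      ((4, 3), (16, 2), (25, 1), (0, 0)), ((14, 0), (22, 4), (23, 4), (0, 0)),
      ((2, 1), (4, 4), (14, 5), (0, 0)), ((3, 0), (21, 3), (26, 3), (0, 0)),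
      ((2, 5), (5, 1), (17, 4), (0, 0)), ((10, 4), (14, 4), (17, 1), (0, 0)),
      ((1, 5), (10, 5), (20, 2), (0, 0)), ((18, 2), (19, 5), (21, 4), (0, 0)),
      ((1, 2), (9, 2), (26, 4), (0, 3)), ((3, 1), (4, 3), (5, 0), (0, 3)),
      ((9, 1), (15, 2), (20, 0), (0, 3)), ((4, 2), (5, 3), (11, 3), (0, 0)),
      ((9, 0), (20, 5), (22, 5), (0, 0)), ((7, 0), (13, 4), (16, 5), (0, 0)),
      ((1, 4), (2, 3), (12, 2), (0, 0)), ((13, 5), (19, 0), (22, 4), (0, 3)),
      ((2, 0), (9, 3), (21, 3), (0, 3)), ((3, 2), (12, 5), (25, 4), (0, 3)),
      ((5, 4), (10, 0), (24, 5), (0, 3)), ((2, 3), (4, 0), (19, 3), (0, 3)),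
      ((9, 4), (13, 3), (16, 5), (0, 3)), ((1, 3), (12, 3), (21, 4), (0, 3)),
      ((1, 4), (7, 5), (11, 3), (0, 3)), ((12, 4), (14, 5), (19, 4), (0, 3)),
      ((5, 3), (6, 4), (17, 5), (0, 3)), ((11, 5), (17, 4), (25, 5), (0, 3))]"
  by (simp add: base_ok_simps)

lemma base_outer_27: "base_ok 27 27 3 6 9
     [((4, 1), (6, 0), (9, 2), (0, 6)), ((1, 1), (2, 0), (24, 3), (0, 6)),
      ((13, 0), (20, 1), (24, 2), (0, 6)), ((7, 5), (16, 2), (24, 0), (0, 6)),
      ((3, 1), (13, 2), (15, 2), (0, 6)), ((10, 4), (14, 1), (22, 0), (0, 6)),
      ((6, 1), (20, 0), (26, 2), (0, 6)), ((11, 2), (23, 1), (25, 2), (0, 6)),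
      ((8, 3), (19, 0), (25, 0), (0, 6)), ((5, 2), (13, 3), (15, 1), (0, 6)),
      ((7, 1), (16, 1), (19, 3), (0, 6)), ((2, 4), (12, 1), (22, 1), (0, 6)),
      ((2, 2), (3, 2), (16, 5), (0, 6)), ((6, 2), (12, 0), (20, 3), (0, 6)),
      ((8, 0), (9, 1), (17, 1), (0, 6)), ((2, 5), (8, 2), (20, 2), (0, 6)),
      ((10, 0), (14, 0), (19, 4), (0, 6)), ((1, 2), (21, 2), (22, 4), (0, 6)),
      ((9, 5), (23, 0), (26, 1), (0, 6)), ((11, 3), (17, 2), (21, 1), (0, 6)),
      ((2, 1), (5, 1), (22, 5), (0, 6)), ((3, 4), (7, 0), (18, 1), (0, 6)),
      ((8, 1), (17, 0), (19, 5), (0, 6)), ((12, 2), (14, 3), (23, 2), (0, 6)),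
      ((10, 5), (21, 0), (26, 0), (0, 6)), ((5, 0), (11, 5), (18, 2), (0, 6)),
      ((3, 0), (5, 3), (25, 1), (0, 6)), ((8, 4), (24, 1), (25, 5), (0, 6)),
      ((1, 3), (4, 0), (10, 3), (0, 6)), ((7, 2), (21, 4), (25, 4), (0, 6)),
      ((17, 3), (22, 2), (26, 4), (0, 6)), ((11, 4), (17, 5), (19, 1), (0, 6)),
      ((12, 4), (13, 1), (14, 4), (0, 6)), ((3, 3), (4, 2), (13, 4), (0, 6)),
      ((14, 2), (18, 5), (21, 3), (0, 6)), ((9, 4), (10, 2), (13, 5), (0, 6)),
      ((1, 0), (16, 3), (23, 5), (0, 6)), ((7, 3), (9, 0), (15, 4), (0, 6)),
      ((8, 5), (11, 1), (14, 5), (0, 6)), ((3, 5), (4, 5), (11, 0), (0, 6)),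
      ((7, 4), (12, 5), (15, 0), (0, 6)), ((4, 4), (18, 0), (26, 5), (0, 6)),
      ((10, 1), (15, 3), (25, 3), (0, 6)), ((5, 4), (16, 0), (20, 4), (0, 6)),
      ((4, 3), (19, 2), (24, 5), (0, 6)), ((1, 5), (6, 5), (20, 5), (0, 6)),
      ((6, 3), (18, 4), (22, 3), (0, 6)), ((5, 5), (6, 4), (18, 3), (0, 6)),
      ((2, 3), (16, 4), (23, 4), (0, 6)), ((21, 5), (23, 3), (24, 4), (0, 6)),
      ((15, 5), (17, 4), (26, 3), (0, 6)), ((1, 4), (9, 3), (12, 3), (0, 6))]"
  by (simp add: base_ok_simps)

lemma admissible_base:
  assumes "t \<in> {4..19} \<union> {23, 27}"
  shows "admissible t"
proof -
  have "t \<in> set [4, 5, 6, 7, 8, 9, 10, 11, 12, 13, 14, 15, 16, 17, 18, 19, 23, 27]"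
    using assms by (auto simp: eval_nat_numeral le_Suc_eq)
  then show ?thesis
    using admissibleI[OF base_inner_4 base_outer_4]
      admissibleI[OF base_inner_5 base_outer_5]
      admissibleI[OF base_inner_6 base_outer_6]
      admissibleI[OF base_inner_7 base_outer_7]
      admissibleI[OF base_inner_8 base_outer_8]
      admissibleI[OF base_inner_9 base_outer_9]
      admissibleI[OF base_inner_10 base_outer_10]
      admissibleI[OF base_inner_11 base_outer_11]
      admissibleI[OF base_inner_12 base_outer_12]
      admissibleI[OF base_inner_13 base_outer_13]
      admissibleI[OF base_inner_14 base_outer_14]
      admissibleI[OF base_inner_15 base_outer_15]
      admissibleI[OF base_inner_16 base_outer_16]
      admissibleI[OF base_inner_17 base_outer_17]
      admissibleI[OF base_inner_18 base_outer_18]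
      admissibleI[OF base_inner_19 base_outer_19]
      admissibleI[OF base_inner_23 base_outer_23]
      admissibleI[OF base_inner_27 base_outer_27]
    by auto
qed

section \<open>All numbers of groups\<close>

definition group_sizes :: "nat \<Rightarrow> nat \<Rightarrow> nat \<Rightarrow> nat \<Rightarrow> nat \<Rightarrow> nat" where
  "group_sizes m x y z j = (if j < 4 then m else if j = 4 then x else if j = 5 then y else z)"

text \<open>Six groups require the differences 1, 2, 3, 4 to be units modulo \<open>m\<close>, that
  is, \<open>m\<close> coprime to 6.\<close>

lemma admissible_td6:
  assumes m: "coprime m 6" "admissible m" "0 < m"
    and xy: "x \<le> m" "x \<le> 1 \<or> admissible x" "y \<le> m" "y \<le> 1 \<or> admissible y"
    and base: "admissible 4" "admissible 5" "admissible 6"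
  shows "admissible (4 * m + x + y)"
proof -
  have "admissible (\<Sum>j<6. group_sizes m x y 0 j)"
  proof (rule admissible_transversal_design[of 6 m])
    fix d :: nat assume "0 < d" "d + 1 < 6"
    then have "d \<in> {1, 2, 3, 4}" by auto
    moreover have "coprime m 2" "coprime m 3"
      using m(1) coprime_mult_right_iff[of m 2 3] by simp_all
    moreover from this(1) have "coprime m 4"
      using coprime_mult_right_iff[of m 2 2] by simp
    ultimately show "coprime d m" by (auto simp: coprime_commute)
  next
    fix n :: nat assume "4 \<le> n" "n \<le> 6"
    then have "n = 4 \<or> n = 5 \<or> n = 6" by auto
    with base show "admissible n" by auto
  qed (use m xy in \<open>auto simp: group_sizes_def\<close>)
  also have "(\<Sum>j<6. group_sizes m x y 0 j) = 4 * m + x + y"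
    by (simp add: eval_nat_numeral group_sizes_def)
  finally show ?thesis .
qed

text \<open>A seventh group adds the difference 5, hence 30 instead of 6. It serves the few
  \<open>t\<close> that two truncated groups do not reach.\<close>

lemma admissible_td7:
  assumes m: "coprime m 30" "admissible m" "0 < m"
    and xyz: "x \<le> m" "x \<le> 1 \<or> admissible x" "y \<le> m" "y \<le> 1 \<or> admissible y" "z \<le> m" "z \<le> 1 \<or> admissible z"
    and base: "admissible 4" "admissible 5" "admissible 6" "admissible 7"
  shows "admissible (4 * m + x + y + z)"
proof -
  have "admissible (\<Sum>j<7. group_sizes m x y z j)"
  proof (rule admissible_transversal_design[of 7 m])
    fix d :: nat assume "0 < d" "d + 1 < 7"
    then have "d \<in> {1, 2, 3, 4, 5}" by auto
    moreover have "coprime m 2" "coprime m 15"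
      using m(1) coprime_mult_right_iff[of m 2 15] by simp_all
    moreover from this have "coprime m 4" "coprime m 3" "coprime m 5"
      using coprime_mult_right_iff[of m 2 2] coprime_mult_right_iff[of m 3 5] by simp_all
    ultimately show "coprime d m" by (auto simp: coprime_commute)
  next
    fix n :: nat assume "4 \<le> n" "n \<le> 7"
    then have "n = 4 \<or> n = 5 \<or> n = 6 \<or> n = 7" by auto
    with base show "admissible n" by auto
  qed (use m xyz in \<open>auto simp: group_sizes_def\<close>)
  also have "(\<Sum>j<7. group_sizes m x y z j) = 4 * m + x + y + z"
    by (simp add: eval_nat_numeral group_sizes_def)
  finally show ?thesis .
qed

lemma coprime_6_iff: "coprime m (6 :: nat) \<longleftrightarrow> odd m \<and> \<not> 3 dvd m"
proof -
  have "coprime m 6 \<longleftrightarrow> coprime m 2 \<and> coprime m 3"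
    using coprime_mult_right_iff[of m 2 3] by simp
  moreover have "coprime m 3 \<longleftrightarrow> \<not> 3 dvd m"
    using prime_imp_coprime[of "3 :: nat" m] by (auto simp: coprime_commute)
  ultimately show ?thesis by simp
qed

text \<open>The numbers coprime to 6 are those congruent to 1 or 5 modulo 6, with gaps 4 and 2, so
  every run of four consecutive numbers contains one. Since 11 is itself of this kind, the result
  does not fall below 11.\<close>

lemma coprime_6_below:
  fixes n :: nat
  assumes "11 \<le> n"
  obtains m where "11 \<le> m" "m \<le> n" "n < m + 4" "coprime m 6"
proof -
  define q where "q = n div 6"
  have q: "6 * q \<le> n" "n < 6 * q + 6" unfolding q_def by linarith+
  have cop: "coprime (6 * k + 1) 6" "coprime (6 * k + 5) 6" for k :: nat
    unfolding coprime_6_iff by presburger+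
  consider "n = 6 * q" | "6 * q < n" "n < 6 * q + 5" | "n = 6 * q + 5" using q by linarith
  then show thesis
  proof cases
    case 1
    then show thesis using assms cop(2)[of "q - 1"] by (intro that[of "6 * (q - 1) + 5"]) (assumption | presburger)+
  next
    case 2
    then show thesis using assms cop(1)[of q] by (intro that[of "6 * q + 1"]) (assumption | presburger)+
  next
    case 3
    then show thesis using assms cop(2)[of q] by (intro that[of "6 * q + 5"]) (assumption | presburger)+
  qed
qed

text \<open>By strong induction \<open>t\<close> is written as \<open>4 * m + x + y\<close> with
  truncated sizes \<open>x, y <= m\<close>. The sizes 2 and 3 are the ones to avoid, being neither
  trivial nor covered by the induction; the case split is arranged around them.\<close>

lemma admissible_all:
  assumes "4 \<le> t"
  shows "admissible t"
  using assms
proof (induction t rule: less_induct)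
  case (less t)
  note base = admissible_base
  note small = base[of 4] base[of 5] base[of 6] base[of 7]
  have td6: "admissible (4 * m + x + y)"
    if "coprime m 6" "4 \<le> m" "m < t" "x \<le> m" "x \<le> 1 \<or> 4 \<le> x" "y \<le> m" "y \<le> 1 \<or> 4 \<le> y" for m x y
    using that small less.IH by (intro admissible_td6) auto
  have td6': "admissible t" if "t = 4 * m + x + y" "coprime m 6" "4 \<le> m" "x \<le> m" "x \<le> 1 \<or> 4 \<le> x" "y \<le> m" "y \<le> 1 \<or> 4 \<le> y" for m x y
    using td6[of m x y] that by simp
  show ?case
  proof (cases "t < 48")
    case True
    have cop: "coprime (5 :: nat) 6" "coprime (7 :: nat) 6" "coprime (11 :: nat) 6"
      by (simp_all add: coprime_6_iff)
    have cop30: "coprime (7 :: nat) 30" "coprime (11 :: nat) 30"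
      by (simp_all add: coprime_iff_gcd_eq_1 gcd_non_0_nat)
    have "t \<le> 19 \<or> t = 23 \<or> t = 27 \<or> t = 31 \<or> t = 47 \<or>
      t = 20 \<or> t = 21 \<or> t = 22 \<or> t = 24 \<or> t = 25 \<or> t = 26 \<or>
      t = 28 \<or> t = 29 \<or> t = 30 \<or> 32 \<le> t \<and> t \<le> 35 \<or> 36 \<le> t \<and> t \<le> 39 \<or> 40 \<le> t \<and> t \<le> 42 \<or>
      t = 43 \<or> t = 44 \<or> t = 45 \<or> t = 46"
      using True by presburger
    then consider "t \<le> 19 \<or> t = 23 \<or> t = 27" | "t = 31" | "t = 47"
      | "t = 20" | "t = 21" | "t = 22" | "t = 24" | "t = 25" | "t = 26"
      | "t = 28" | "t = 29" | "t = 30" | "32 \<le> t" "t \<le> 35" | "36 \<le> t" "t \<le> 39" | "40 \<le> t" "t \<le> 42"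
      | "t = 43" | "t = 44" | "t = 45" | "t = 46"
      by blast
    then show ?thesis
    proof cases
      case 1 then show ?thesis using base less.prems by auto
    next
      \<comment> \<open>The excess 3 of 31 over 28 does not split into two permitted sizes, but it
        does split into three singletons; likewise 47 over 44.\<close>
      case 2 then show ?thesis using admissible_td7[of 7 1 1 1] cop30 small by simp
    next
      case 3 then show ?thesis using admissible_td7[of 11 1 1 1] cop30 small base[of 11] by simp
    next
      case 4 then show ?thesis using td6'[of 5 0 0] cop by simp
    next
      case 5 then show ?thesis using td6'[of 5 1 0] cop by simp
    next
      case 6 then show ?thesis using td6'[of 5 1 1] cop by simp
    next
      case 7 then show ?thesis using td6'[of 5 4 0] cop by simp
    next
      case 8 then show ?thesis using td6'[of 5 5 0] cop by simp
    next
      case 9 then show ?thesis using td6'[of 5 5 1] cop by simp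
    next
      case 10 then show ?thesis using td6'[of 7 0 0] cop by simp
    next
      case 11 then show ?thesis using td6'[of 7 1 0] cop by simp
    next
      case 12 then show ?thesis using td6'[of 7 1 1] cop by simp
    next
      case 13 show ?thesis by (rule td6'[of 7 "t - 28" 0]) (use 13 cop in auto)
    next
      case 14 show ?thesis by (rule td6'[of 7 "t - 32" 4]) (use 14 cop in auto)
    next
      case 15 show ?thesis by (rule td6'[of 7 "t - 35" 7]) (use 15 cop in auto)
    next
      \<comment> \<open>43 lies just between the full six groups of size 7, with 42 points, and four
        groups of size 11, with 44.\<close>
      case 16 then show ?thesis using admissible_td7[of 7 7 7 1] cop30 small by simp
    next
      case 17 then show ?thesis using td6'[of 11 0 0] cop by simp
    next
      case 18 then show ?thesis using td6'[of 11 1 0] cop by simp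
    next
      case 19 then show ?thesis using td6'[of 11 1 1] cop by simp
    qed
  next
    case False
    \<comment> \<open>The largest \<open>n\<close> with \<open>4 * n + 4 <= t\<close>. As
      \<open>m\<close> is at least \<open>n - 3\<close>, the excess \<open>t - 4 * m\<close> lies
      between 4 and 19, and 19 is below \<open>2 * m\<close> because \<open>m >= 11\<close>.\<close>
    define n where "n = (t - 4) div 4"
    have n: "4 * n + 4 \<le> t" "t < 4 * n + 8" "11 \<le> n" using False by (auto simp: n_def)
    obtain m where m: "11 \<le> m" "m \<le> n" "n < m + 4" "coprime m 6" using coprime_6_below[OF n(3)] .
    show ?thesis
    proof (cases "t \<le> 5 * m")
      case True
      show ?thesis by (rule td6'[of m "t - 4 * m" 0]) (use True m n in linarith)+
    next
      case f: False
      show ?thesis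
      proof (cases "t \<le> 5 * m + 4")
        case True
        \<comment> \<open>The excess is between \<open>m + 1\<close> and \<open>m + 4\<close>;
          filling one group completely could leave 2 or 3 points, so a group of size 4 is split off
          instead.\<close>
        show ?thesis by (rule td6'[of m "t - 4 * m - 4" 4]) (use True f m n in linarith)+
      next
        case g: False
        \<comment> \<open>Now one group can be full, since between 5 and 8 points remain for the
          other.\<close>
        show ?thesis by (rule td6'[of m m "t - 5 * m"]) (use g m n in linarith)+
      qed
    qed
  qed
qed

section \<open>Filling the groups\<close>

text \<open>A (6,3,2)-BIBD strongly nested in eleven points.  Any two of its blocks meet, so the points
  \<open>6..10\<close> outside the design serve one block each.\<close>

definition bibd6 :: "(nat set \<times> nat) list" where
  "bibd6 = [({0, 1, 2}, 3), ({0, 1, 3}, 5), ({0, 2, 4}, 1), ({0, 3, 5}, 4), ({0, 4, 5}, 2),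
     ({1, 2, 5}, 6), ({1, 3, 4}, 7), ({1, 4, 5}, 8), ({2, 3, 4}, 9), ({2, 3, 5}, 10)]"

lemma bibd6_block:
  assumes "W \<in> set bibd6"
  shows "card (fst W) = 3" "fst W \<subseteq> {..<6}" "snd W < 11" "snd W \<notin> fst W"
  using assms by (auto simp: bibd6_def)

lemma bibd6_snd_inj: "inj_on snd (set bibd6)"
  by (simp add: bibd6_def)

text \<open>Two blocks share a nested pair only if their nesting points agree or if each block
  contains the nesting point of the other. The nesting points in the list are all different, and the
  second situation is excluded by inspection.\<close>

lemma bibd6_nested:
  assumes "W \<in> set bibd6" "W' \<in> set bibd6" "joined W a b" "joined W' a b"
  shows "W = W'"
proof -
  have "\<forall>W\<in>set bibd6. \<forall>W'\<in>set bibd6. snd W' \<in> fst W \<longrightarrow> snd W \<notin> fst W'"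
    by (simp add: bibd6_def)
  then have "\<not> (snd W' \<in> fst W \<and> snd W \<in> fst W')" using assms(1,2) by blast
  then have "snd W = snd W'" using assms(3,4) by (auto simp: joined_def)
  then show ?thesis using inj_onD[OF bibd6_snd_inj] assms(1,2) by blast
qed

lemma bibd6_balanced:
  assumes "a < 6" "b < 6" "a \<noteq> b"
  shows "card {W \<in> set bibd6. a \<in> fst W \<and> b \<in> fst W} = 2"
proof -
  have "distinct (map snd bibd6)" by (simp add: bibd6_def)
  then have "distinct bibd6" by (simp add: distinct_map)
  then have "card (set (filter (\<lambda>W. a \<in> fst W \<and> b \<in> fst W) bibd6)) = length (filter (\<lambda>W. a \<in> fst W \<and> b \<in> fst W) bibd6)"
    by (intro distinct_card) simp
  moreover have len: "\<forall>a\<in>set [0, 1, 2, 3, 4, 5]. \<forall>b\<in>set [0, 1, 2, 3, 4, 5]. a \<noteq> b \<longrightarrow>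
    length (filter (\<lambda>W. a \<in> fst W \<and> b \<in> fst W) bibd6) = 2"
    by (simp add: bibd6_def)
  have "a \<in> set [0, 1, 2, 3, 4, 5]" "b \<in> set [0, 1, 2, 3, 4, 5]" using assms(1,2) by auto
  from len[rule_format, OF this assms(3)]
  have "length (filter (\<lambda>W. a \<in> fst W \<and> b \<in> fst W) bibd6) = 2" .
  ultimately show ?thesis by simp
qed

section \<open>From pointed blocks to a strongly nested BIBD\<close>

text \<open>A set of pointed blocks can stand for the multiset of blocks: a repeated block must
  carry different nesting points, since otherwise its nested pairs would repeat. The bijection
  \<open>h\<close> numbers the pointed blocks and \<open>prod_encode\<close> turns points into
  naturals.\<close>

lemma strong_nesting_encode:
  fixes X Y :: "point set"
  assumes "finite Y" "X \<subseteq> Y"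
    and block: "\<And>Z. Z \<in> Q \<Longrightarrow> fst Z \<subseteq> X \<and> card (fst Z) = 3 \<and> snd Z \<in> Y \<and> snd Z \<notin> fst Z"
    and balanced: "\<And>p q. p \<in> X \<Longrightarrow> q \<in> X \<Longrightarrow> p \<noteq> q \<Longrightarrow> card {Z \<in> Q. p \<in> fst Z \<and> q \<in> fst Z} = 2"
    and nest: "\<And>p q Z Z'. Z \<in> Q \<Longrightarrow> Z' \<in> Q \<Longrightarrow> joined Z p q \<Longrightarrow> joined Z' p q \<Longrightarrow> Z = Z'"
  shows "\<exists>(X' :: nat set) (Y' :: nat set) (I :: nat set) (B :: nat \<Rightarrow> nat set) (phi :: nat \<Rightarrow> nat).
    is_bibd X' I B (card X) 3 2 \<and> X' \<subseteq> Y' \<and> finite Y' \<and> card Y' = card Y \<and> strong_nesting I B Y' phi"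
proof -
  let ?e = "prod_encode :: point \<Rightarrow> nat"
  have e: "inj_on ?e S" for S by (rule inj_prod_encode)
  have mem: "?e p \<in> ?e ` S \<longleftrightarrow> p \<in> S" for p S by (simp add: inj_image_mem_iff[OF inj_prod_encode])
  have finX: "finite X" using assms(1,2) by (rule finite_subset[rotated])
  have "Q \<subseteq> Pow X \<times> Y" using block by (intro subsetI) (simp add: mem_Times_iff)
  then have "finite Q" by (rule finite_subset) (use finX assms(1) in simp)
  then obtain h where h: "bij_betw h {..<card Q} Q"
    using ex_bij_betw_nat_finite by (metis atLeast0LessThan)
  have hQ: "h i \<in> Q" if "i < card Q" for i using h that by (auto simp: bij_betw_def)
  have h_inj: "inj_on h {..<card Q}" using h by (simp add: bij_betw_def)
  define I where "I = {..<card Q}"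
  define B where "B i = ?e ` fst (h i)" for i
  define phi where "phi i = ?e (snd (h i))" for i
  have "is_bibd (?e ` X) I B (card X) 3 2"
    unfolding is_bibd_def
  proof (intro conjI ballI impI)
    show "finite (?e ` X)" "finite I" using finX by (simp_all add: I_def)
    show "card (?e ` X) = card X" by (rule card_image[OF e])
    show "B i \<subseteq> ?e ` X" "card (B i) = 3" if "i \<in> I" for i
      using block[OF hQ[of i]] that card_image[OF e] by (auto simp: B_def I_def)
    fix x y assume "x \<in> ?e ` X" "y \<in> ?e ` X" "x \<noteq> y"
    then obtain p q where pq: "x = ?e p" "y = ?e q" "p \<in> X" "q \<in> X" "p \<noteq> q" by blast
    have "h ` {i \<in> I. x \<in> B i \<and> y \<in> B i} = {Z \<in> Q. p \<in> fst Z \<and> q \<in> fst Z}"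
    proof -
      have "h ` {i \<in> {..<card Q}. R (h i)} = {Z \<in> h ` {..<card Q}. R Z}" for R by blast
      then show ?thesis using h by (simp add: B_def I_def pq(1,2) mem bij_betw_def)
    qed
    moreover have "inj_on h {i \<in> I. x \<in> B i \<and> y \<in> B i}"
      by (rule inj_on_subset[OF h_inj]) (auto simp: I_def)
    ultimately show "card {i \<in> I. x \<in> B i \<and> y \<in> B i} = 2"
      using balanced[OF pq(3-5)] card_image by fastforce
  qed
  moreover have "strong_nesting I B (?e ` Y) phi"
    unfolding strong_nesting_def
  proof (intro conjI ballI)
    show "phi i \<in> ?e ` Y" "phi i \<notin> B i" if "i \<in> I" for i
      using block[OF hQ[of i]] that by (auto simp: B_def I_def phi_def mem)
    show "inj_on (\<lambda>(i, x). {x, phi i}) (SIGMA i:I. B i)"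
    proof (rule inj_onI)
      fix u v assume uv: "u \<in> (SIGMA i:I. B i)" "v \<in> (SIGMA i:I. B i)"
        and eq: "(\<lambda>(i, x). {x, phi i}) u = (\<lambda>(i, x). {x, phi i}) v"
      obtain i p where u: "u = (i, ?e p)" "i < card Q" "p \<in> fst (h i)" using uv(1) by (auto simp: I_def B_def)
      obtain j q where v: "v = (j, ?e q)" "j < card Q" "q \<in> fst (h j)" using uv(2) by (auto simp: I_def B_def)
      have "{?e p, ?e (snd (h i))} = {?e q, ?e (snd (h j))}" using eq by (simp add: u v phi_def)
      then have pq: "p = q \<and> snd (h i) = snd (h j) \<or> p = snd (h j) \<and> snd (h i) = q"
        using prod_encode_eq by (metis doubleton_eq_iff)
      then have "joined (h j) p (snd (h i))" "joined (h i) p (snd (h i))"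
        using u(3) v(3) by (auto simp: joined_def)
      then have "h i = h j" using nest[OF hQ[OF u(2)] hQ[OF v(2)]] by blast
      then have "i = j" using inj_onD[OF h_inj] u(2) v(2) by blast
      \<comment> \<open>The crossed case would make \<open>p\<close> the nesting point of the very
        block that contains it.\<close>
      moreover have "p = q" using pq \<open>h i = h j\<close> block[OF hQ[OF u(2)]] u(3) by metis
      ultimately show "u = v" by (simp add: u v)
    qed
  qed
  moreover have "?e ` X \<subseteq> ?e ` Y" "finite (?e ` Y)" using assms(1,2) by auto
  moreover have "card (?e ` Y) = card Y" by (rule card_image[OF e])
  ultimately show ?thesis by blast
qed

lemma strong_nesting_of_pointed_gdds:
  assumes F: "pointed_gdd {..<t} {0..<6} F" and G: "pointed_gdd {..<t} {6..<9} G"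
  shows "\<exists>(X :: nat set) (Y :: nat set) (I :: nat set) (B :: nat \<Rightarrow> nat set) (phi :: nat \<Rightarrow> nat).
           is_bibd X I B (6 * t) 3 2 \<and> X \<subseteq> Y \<and> finite Y \<and> card Y = 9 * t + 2 \<and>
           strong_nesting I B Y phi"
proof -
  define X where "X = {..<t} \<times> {..<6::nat}"
  define Y where "Y = {..<t} \<times> {..<9::nat} \<union> {(t, 9), (t, 10)}"
  \<comment> \<open>Labels 9 and 10 go to the extra index \<open>t\<close> whatever \<open>i\<close>
    is: these are the two outer points shared by all groups.\<close>
  define emb where "emb i W = (Pair i ` fst W, if snd W < 9 then i else t, snd W)"
    for i and W :: "nat set \<times> nat"
  define H where "H = (\<Union>i<t. emb i ` set bibd6)"
  define Q where "Q = F \<union> G \<union> H"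
  note DF = pointed_gddD[OF F] and DG = pointed_gddD[OF G]
  have memX: "p \<in> X \<longleftrightarrow> fst p < t \<and> snd p < 6" for p by (auto simp: X_def mem_Times_iff)
  have memE: "p \<in> fst (emb i W) \<longleftrightarrow> fst p = i \<and> snd p \<in> fst W" for p i W
    by (cases p) (auto simp: emb_def)
  have sndE: "snd (snd (emb i W)) = snd W" for i W by (simp add: emb_def)
  have emb_inj: "inj_on (emb i) (set bibd6)" for i
    by (rule inj_onI) (metis sndE inj_onD[OF bibd6_snd_inj])
  have H: "\<exists>i<t. \<exists>W\<in>set bibd6. Z = emb i W" if "Z \<in> H" for Z
    using that by (auto simp: H_def)
  have subX: "p \<in> X" if "Z \<in> Q" "p \<in> fst Z" for p Z
    using that DF(2)[of Z p] DG(2)[of Z p] H[of Z] memE bibd6_block(2) unfolding Q_def memX by fastforce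
  have block: "fst Z \<subseteq> X \<and> card (fst Z) = 3 \<and> snd Z \<in> Y \<and> snd Z \<notin> fst Z" if Z: "Z \<in> Q" for Z
  proof (intro conjI)
    show "fst Z \<subseteq> X" using subX[OF Z] by blast
    consider "Z \<in> F" | "Z \<in> G" | i W where "i < t" "W \<in> set bibd6" "Z = emb i W"
      using Z H unfolding Q_def by blast
    then show "card (fst Z) = 3" "snd Z \<in> Y" "snd Z \<notin> fst Z"
    proof (atomize(full), cases)
      case 1
      then show "card (fst Z) = 3 \<and> snd Z \<in> Y \<and> snd Z \<notin> fst Z"
        using DF(1,4)[OF 1] DF(5)[OF 1, of "snd Z"] by (auto simp: Y_def mem_Times_iff)
    next
      case 2
      then show "card (fst Z) = 3 \<and> snd Z \<in> Y \<and> snd Z \<notin> fst Z"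
        using DG(1,4)[OF 2] DG(5)[OF 2, of "snd Z"] by (auto simp: Y_def mem_Times_iff)
    next
      case 3
      have "card (fst Z) = card (fst W)" unfolding 3(3) emb_def fst_conv
        by (rule card_image) (auto intro: inj_onI)
      moreover have "snd W = 9 \<or> snd W = 10" if "\<not> snd W < 9" using that bibd6_block(3)[OF 3(2)] by linarith
      ultimately show "card (fst Z) = 3 \<and> snd Z \<in> Y \<and> snd Z \<notin> fst Z"
        using bibd6_block[OF 3(2)] 3(1) memE[of "snd Z" i W] by (auto simp: 3(3) emb_def Y_def)
    qed
  qed
  have balanced: "card {Z \<in> Q. p \<in> fst Z \<and> q \<in> fst Z} = 2" if pq: "p \<in> X" "q \<in> X" "p \<noteq> q" for p q
  proof (cases "fst p = fst q")
    case True
    have notF: "\<not> (p \<in> fst Z \<and> q \<in> fst Z)" if "Z \<in> F \<or> Z \<in> G" for Z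
      using that DF(3)[of Z] DG(3)[of Z] True pq(3) by (metis inj_onD)
    have "{Z \<in> Q. p \<in> fst Z \<and> q \<in> fst Z} = emb (fst p) ` {W \<in> set bibd6. snd p \<in> fst W \<and> snd q \<in> fst W}"
      (is "?L = ?R")
    proof
      show "?L \<subseteq> ?R"
      proof
        fix Z assume Z: "Z \<in> ?L"
        then obtain i W where "i < t" "W \<in> set bibd6" "Z = emb i W" using notF H unfolding Q_def by blast
        with Z memE show "Z \<in> ?R" by auto
      qed
      show "?R \<subseteq> ?L"
      proof
        fix Z assume "Z \<in> ?R"
        then obtain W where W: "W \<in> set bibd6" "snd p \<in> fst W" "snd q \<in> fst W" "Z = emb (fst p) W" by blast
        then have "Z \<in> H" using pq(1) unfolding H_def memX by blast
        moreover have "p \<in> fst Z" "q \<in> fst Z" unfolding W(4) memE using W True by simp_all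
        ultimately show "Z \<in> ?L" by (simp add: Q_def)
      qed
    qed
    moreover have "snd p \<noteq> snd q" using True pq(3) by (simp add: prod_eq_iff)
    ultimately show ?thesis
      using bibd6_balanced[of "snd p" "snd q"] pq(1,2) card_image[OF inj_on_subset[OF emb_inj]]
      by (simp add: memX)
  next
    case False
    have mem: "p \<in> {..<t} \<times> {..<6}" "q \<in> {..<t} \<times> {..<6}" using pq by (simp_all add: X_def)
    obtain Z1 where Z1: "Z1 \<in> F" "p \<in> fst Z1" "q \<in> fst Z1"
      and uniq1: "\<And>Z. Z \<in> F \<Longrightarrow> p \<in> fst Z \<Longrightarrow> q \<in> fst Z \<Longrightarrow> Z = Z1"
      using DF(6)[OF mem False] by blast
    obtain Z2 where Z2: "Z2 \<in> G" "p \<in> fst Z2" "q \<in> fst Z2"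
      and uniq2: "\<And>Z. Z \<in> G \<Longrightarrow> p \<in> fst Z \<Longrightarrow> q \<in> fst Z \<Longrightarrow> Z = Z2"
      using DG(6)[OF mem False] by blast
    have "Z \<notin> H" if "p \<in> fst Z" "q \<in> fst Z" for Z using that H[of Z] memE False by metis
    then have "{Z \<in> Q. p \<in> fst Z \<and> q \<in> fst Z} = {Z1, Z2}"
      using Z1 Z2 uniq1 uniq2 unfolding Q_def by blast
    \<comment> \<open>The two blocks may be equal as sets, but they are nested at labels below 6 and
      from 6 on, so the pair is counted twice.\<close>
    moreover have "Z1 \<noteq> Z2" using DF(4)[OF Z1(1)] DG(4)[OF Z2(1)] by auto
    ultimately show ?thesis by simp
  qed
  have nest: "Z = Z'" if Z: "Z \<in> Q" "Z' \<in> Q" "joined Z p q" "joined Z' p q" for p q Z Z'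
  proof -
    have jF: "fst p < t \<and> fst q < t \<and> fst p \<noteq> fst q \<and> snd p < 6 \<and> snd q < 6" if "Z \<in> F" "joined Z p q" for Z
      using joined_fst[OF F that] DF(2,4)[OF that(1)] that(2) unfolding joined_def by (elim disjE conjE) simp_all
    have jG: "fst p < t \<and> fst q < t \<and> fst p \<noteq> fst q \<and> \<not> (snd p < 6 \<and> snd q < 6)" if "Z \<in> G" "joined Z p q" for Z
      using joined_fst[OF G that] DG(4)[OF that(1)] that(2) unfolding joined_def by (elim disjE conjE) auto
    \<comment> \<open>A nested pair of the filling lies in one group or has one end at the extra
      index \<open>t\<close>. In both cases the index different from \<open>t\<close> recovers the
      group, so copies of the filling in different groups cannot clash at the shared points.\<close>
    have jH: "joined W (snd p) (snd q) \<and> (fst p = fst q \<or> fst p = t \<or> fst q = t)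
        \<and> (if fst p = t then fst q else fst p) = i"
      if "i < t" "W \<in> set bibd6" "joined (emb i W) p q" for i W
      using that memE unfolding joined_def emb_def by (auto split: if_splits)
    \<comment> \<open>GDD and frame pairs have two distinct indices below \<open>t\<close>, unlike
      filling pairs, and are told apart from each other by whether both labels are below 6.\<close>
    consider "Z \<in> F" "Z' \<in> F" | "Z \<in> G" "Z' \<in> G" | "Z \<in> H" "Z' \<in> H"
      using Z jF jG jH H unfolding Q_def by (metis UnE less_irrefl)
    then show ?thesis
    proof cases
      case 1 then show ?thesis using DF(7) Z(3,4) by blast
    next
      case 2 then show ?thesis using DG(7) Z(3,4) by blast
    next
      case 3
      obtain i W where W: "i < t" "W \<in> set bibd6" "Z = emb i W" using H[OF 3(1)] by blast
      obtain j V where V: "j < t" "V \<in> set bibd6" "Z' = emb j V" using H[OF 3(2)] by blast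
      have 4: "joined W (snd p) (snd q)" "(if fst p = t then fst q else fst p) = i"
        using jH[OF W(1,2)] Z(3) W(3) by blast+
      have 5: "joined V (snd p) (snd q)" "(if fst p = t then fst q else fst p) = j"
        using jH[OF V(1,2)] Z(4) V(3) by blast+
      have "W = V" by (rule bibd6_nested[OF W(2) V(2) 4(1) 5(1)])
      then show ?thesis using 4(2) 5(2) W(3) V(3) by simp
    qed
  qed
  have "finite Y" "X \<subseteq> Y" by (auto simp: Y_def X_def)
  from strong_nesting_encode[OF this block balanced nest]
  have "\<exists>(X' :: nat set) (Y' :: nat set) (I :: nat set) (B :: nat \<Rightarrow> nat set) (phi :: nat \<Rightarrow> nat).
    is_bibd X' I B (card X) 3 2 \<and> X' \<subseteq> Y' \<and> finite Y' \<and> card Y' = card Y \<and> strong_nesting I B Y' phi" .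
  moreover have "card X = 6 * t" by (simp add: X_def card_cartesian_product)
  moreover have "card Y = 9 * t + 2"
    unfolding Y_def by (subst card_Un_disjoint) (auto simp: card_cartesian_product)
  ultimately show ?thesis by simp
qed

theorem theorem4p6:
  fixes t :: nat
  assumes "t \<ge> 4" and "t \<noteq> 6"
  shows "\<exists>(X :: nat set) (Y :: nat set) (I :: nat set) (B :: nat \<Rightarrow> nat set) (phi :: nat \<Rightarrow> nat).
           is_bibd X I B (6 * t) 3 2 \<and> X \<subseteq> Y \<and> finite Y \<and> card Y = 9 * t + 2 \<and>
           strong_nesting I B Y phi"
proof -
  have "admissible t" using assms(1) by (rule admissible_all)
  then obtain F G where "pointed_gdd {..<t} {0..<6} F" "pointed_gdd {..<t} {6..<9} G"
    by (auto simp: admissible_def)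
  then show ?thesis by (rule strong_nesting_of_pointed_gdds)
qed

end
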